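(* There is a decision problem $\mathcal{L}\subseteq\{0,1\}^{**}$ such that $\mathcal{L}$ is OTM-decidable in running time $\alpha\cdot 4$, but not in running time $\alpha\cdot 2$, where $\alpha$ denotes the length of the input.
   Context: **Words.** $\{0,1\}^{**}$ is the class of all functions from an ordinal to $\{0,1\}$; for $w\in\{0,1\}^{**}$, the length $|w|$ is the domain of $w$. Products are ordinal products. **OTMs.** An Ordinal Turing Machine (OTM, Koepke) is given by an ordinary finite Turing program (without ordinal parameters), run with finitely many tapes (any finite number of scratch tapes is allowed) whose cells are indexed by all ordinals, each cell containing $0$ or $1$, along ordinal time. Successor steps are as for ordinary Turing machines; a head moving left from a cell with limit index goes to cell $0$. At limit times, each cell content is the inferior limit of its earlier contents, the state is the inferior limit of the earlier states (identified with natural numbers), and each head position is the inferior limit of the earlier head positions at those times at which the machine was in this limit state. Inputs in $\{0,1\}^{**}$ are written on the input tape starting at cell $0$, in such a way that the machine can recognize the end of the input (e.g. by markers on an additional tape). A program decides a class $\mathcal{L}\subseteq\{0,1\}^{**}$ if it halts on every input, with output $1$ on inputs in $\mathcal{L}$ and output $0$ on the others. **Running time.** For $k\in\{2,4\}$, $\mathcal{L}$ is OTM-decidable in running time $\alpha\cdot k$ if some OTM-program decides $\mathcal{L}$ and halts in at most $|w|\cdot k$ many steps on every nonempty input $w$. *)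

theory Defs
  imports Main
begin

section \<open>Ordinals\<close>

text \<open>
  HOL has no type that contains all ordinals. As usual when class-sized mathematics is done
  in a typed setting, the class of all ordinals is replaced by an arbitrary well-ordered type
  that is closed in the way the class of ordinals is: there is an (infinite) limit ordinal, and
  replacement holds, i.e.\ every function from the predecessors of an ordinal to ordinals is
  bounded. In particular there is no greatest element, suprema of set-many ordinals exist, and
  the type is closed under ordinal arithmetic. An instance that contains all ordinals of
  cardinality at most that of a given infinite type is constructed at the end of this theory.
\<close>

class ordinals = wellorder +
  assumes limit_ordinal_exists: "\<exists>l x. x < l \<and> (\<forall>y<l. \<exists>z<l. y < z)"
    and replacement: "\<exists>b. \<forall>y<x. f y < b"

definition ord_zero :: "'o::ordinals" where
  "ord_zero = (LEAST x. True)"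

definition ord_suc :: "'o::ordinals \<Rightarrow> 'o" where
  "ord_suc x = (LEAST y. x < y)"

definition is_suc :: "'o::ordinals \<Rightarrow> bool" where
  "is_suc x \<longleftrightarrow> (\<exists>y. x = ord_suc y)"

definition ord_pred :: "'o::ordinals \<Rightarrow> 'o" where
  "ord_pred x = (THE y. x = ord_suc y)"

definition ord_of_nat :: "nat \<Rightarrow> 'o::ordinals" where
  "ord_of_nat n = (ord_suc ^^ n) ord_zero"

lemma ord_greater_exists: "\<exists>y. (x::'o::ordinals) < y"
proof -
  obtain l w :: 'o where "w < l" and "\<forall>y<l. \<exists>z<l. y < z"
    using limit_ordinal_exists by blast
  with replacement[of l "\<lambda>_. x"] show ?thesis by blast
qed

lemma less_ord_suc: "x < ord_suc (x::'o::ordinals)"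
  unfolding ord_suc_def using ord_greater_exists[of x] by (blast intro: LeastI_ex)

lemma ord_suc_le_iff: "ord_suc x \<le> y \<longleftrightarrow> (x::'o::ordinals) < y"
  using less_ord_suc[of x] by (auto simp: ord_suc_def intro: Least_le order.strict_trans2)

lemma ord_suc_inject: "ord_suc x = ord_suc y \<longleftrightarrow> (x::'o::ordinals) = y"
  by (metis less_ord_suc not_less ord_suc_le_iff order.antisym)

lemma ord_pred_suc [simp]: "ord_pred (ord_suc x) = (x::'o::ordinals)"
  unfolding ord_pred_def by (simp add: ord_suc_inject)

lemma is_suc_ord_suc [simp]: "is_suc (ord_suc x)"
  by (auto simp: is_suc_def)

lemma ord_pred_less: "is_suc x \<Longrightarrow> ord_pred x < (x::'o::ordinals)"
  by (auto simp: is_suc_def less_ord_suc)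

lemma ord_zero_le [simp]: "ord_zero \<le> (x::'o::ordinals)"
  unfolding ord_zero_def by (rule Least_le) simp

lemma ord_suc_not_zero [simp]: "ord_suc x \<noteq> (ord_zero::'o::ordinals)"
  by (metis less_ord_suc not_less ord_zero_le)

text \<open>
  Ordinal sum and product: \<open>a + b = sup ({a} \<union> {(a + c) + 1 | c < b})\<close> and
  \<open>a \<cdot> b = sup {a \<cdot> c + a | c < b}\<close>.
\<close>

function ord_add :: "'o::ordinals \<Rightarrow> 'o \<Rightarrow> 'o" where
  "ord_add a b = (LEAST x. a \<le> x \<and> (\<forall>c\<in>{..<b}. ord_add a c < x))"
  by pat_completeness auto
termination
  by (relation "inv_image {(x, y). x < y} snd") (rule wf_inv_image, rule wf, simp)

declare ord_add.simps [simp del]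

function ord_mult :: "'o::ordinals \<Rightarrow> 'o \<Rightarrow> 'o" where
  "ord_mult a b = (LEAST x. \<forall>c\<in>{..<b}. ord_add (ord_mult a c) a \<le> x)"
  by pat_completeness auto
termination
  by (relation "inv_image {(x, y). x < y} snd") (rule wf_inv_image, rule wf, simp)

declare ord_mult.simps [simp del]

text \<open>
  The inferior limit of \<open>f r\<close> for \<open>r\<close> approaching the limit \<open>t\<close> through the times satisfying
  \<open>P\<close>: the supremum over \<open>s < t\<close> of the minimum of \<open>{f r | s \<le> r < t, P r}\<close>. It is applied to
  ordinals, to natural numbers, and to bits, where \<open>False < True\<close>.
\<close>

definition liminf_at :: "'o::ordinals \<Rightarrow> ('o \<Rightarrow> bool) \<Rightarrow> ('o \<Rightarrow> 'b::linorder) \<Rightarrow> 'b" where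
  "liminf_at t P f =
     (LEAST u. \<forall>s<t. (LEAST v. \<exists>r. s \<le> r \<and> r < t \<and> P r \<and> v = f r) \<le> u)"


section \<open>Words\<close>

text \<open>Words are partial functions whose domain is an ordinal; bits are Booleans (\<open>True\<close> is 1).\<close>

type_synonym 'o word = "'o \<Rightarrow> bool option"

definition words :: "'o::ordinals word set" where
  "words = {w. \<exists>a. dom w = {..<a}}"

definition word_length :: "'o::ordinals word \<Rightarrow> 'o" where
  "word_length w = (THE a. dom w = {..<a})"


section \<open>Ordinal Turing machines\<close>

datatype move = Left | Stay | Right

text \<open>
  A program has the states \<open>0, \<dots>, n_states - 1\<close>. Given a state and the list of the scanned bits
  (one per tape), \<open>instr\<close> gives the new state and, for each tape, the bit to be written and
  the head movement. Only the finitely many values of \<open>instr\<close> on states below \<open>n_states\<close> and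
  lists of length \<open>n_tapes\<close> are ever used. The machine halts when it enters a state
  that is not a state of the program.
  Tape 0 is the input tape, tape 1 marks the end of the input, tape 2 is the output tape,
  and all further tapes are scratch tapes.
\<close>

record program =
  n_tapes :: nat
  n_states :: nat
  instr :: "nat \<Rightarrow> bool list \<Rightarrow> nat \<times> (bool \<times> move) list"

definition wf_program :: "program \<Rightarrow> bool" where
  "wf_program p \<longleftrightarrow> 3 \<le> n_tapes p \<and>
     (\<forall>q bs. q < n_states p \<and> length bs = n_tapes p \<longrightarrow> length (snd (instr p q bs)) = n_tapes p)"

record 'o config =
  state :: nat
  head :: "nat \<Rightarrow> 'o"
  tape :: "nat \<Rightarrow> 'o \<Rightarrow> bool"

definition halted :: "program \<Rightarrow> 'o config \<Rightarrow> bool" where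
  "halted p c \<longleftrightarrow> n_states p \<le> state c"

definition initial_config :: "'o::ordinals word \<Rightarrow> 'o config" where
  "initial_config w =
     \<lparr>state = 0,
      head = (\<lambda>_. ord_zero),
      tape = (\<lambda>i x. if i = 0 then w x = Some True
                    else if i = 1 then x = word_length w
                    else False)\<rparr>"

fun move_head :: "move \<Rightarrow> 'o::ordinals \<Rightarrow> 'o" where
  "move_head Left x = (if is_suc x then ord_pred x else ord_zero)"
| "move_head Stay x = x"
| "move_head Right x = ord_suc x"

definition scanned :: "program \<Rightarrow> 'o config \<Rightarrow> bool list" where
  "scanned p c = map (\<lambda>i. tape c i (head c i)) [0..<n_tapes p]"

text \<open>A configuration in which the machine has halted is kept forever.\<close>

definition next_config :: "program \<Rightarrow> 'o::ordinals config \<Rightarrow> 'o config" where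
  "next_config p c =
     (if halted p c then c
      else let (q, acts) = instr p (state c) (scanned p c) in
        \<lparr>state = q,
         head = (\<lambda>i. if i < n_tapes p then move_head (snd (acts ! i)) (head c i) else head c i),
         tape = (\<lambda>i. if i < n_tapes p then (tape c i)(head c i := fst (acts ! i)) else tape c i)\<rparr>)"

definition limit_config :: "'o::ordinals \<Rightarrow> ('o \<Rightarrow> 'o config) \<Rightarrow> 'o config" where
  "limit_config t C =
     (let q = liminf_at t (\<lambda>_. True) (\<lambda>r. state (C r)) in
        \<lparr>state = q,
         head = (\<lambda>i. liminf_at t (\<lambda>r. state (C r) = q) (\<lambda>r. head (C r) i)),
         tape = (\<lambda>i x. liminf_at t (\<lambda>_. True) (\<lambda>r. tape (C r) i x))\<rparr>)"

text \<open>
  The configuration at time \<open>t\<close>. The conditional in the last line only makes the recursion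
  well-founded; it is removed in \<open>config_at_limit\<close> below.
\<close>

function config_at :: "program \<Rightarrow> 'o::ordinals word \<Rightarrow> 'o \<Rightarrow> 'o config" where
  "config_at p w t =
     (if t = ord_zero then initial_config w
      else if is_suc t then next_config p (config_at p w (ord_pred t))
      else limit_config t (\<lambda>r. if r < t then config_at p w r else initial_config w))"
  by pat_completeness auto
termination
  by (relation "inv_image {(x, y). x < y} (\<lambda>(p, w, t). t)") (rule wf_inv_image, rule wf, simp_all add: ord_pred_less)

declare config_at.simps [simp del]

lemma config_at_zero: "config_at p w ord_zero = initial_config w"
  by (simp add: config_at.simps)

lemma config_at_suc: "config_at p w (ord_suc t) = next_config p (config_at p w t)"
  by (simp add: config_at.simps[of p w "ord_suc t"])

lemma liminf_at_cong:
  assumes "\<And>r. r < t \<Longrightarrow> P r = Q r" "\<And>r. r < t \<Longrightarrow> f r = g r"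
  shows "liminf_at t P f = liminf_at t Q g"
proof -
  have eq: "(s \<le> r \<and> r < t \<and> P r \<and> v = f r) \<longleftrightarrow> (s \<le> r \<and> r < t \<and> Q r \<and> v = g r)" for s r v
    using assms[of r] by auto
  show ?thesis
    unfolding liminf_at_def by (simp only: eq)
qed

lemma limit_config_cong:
  assumes "\<And>r. r < t \<Longrightarrow> C r = D r"
  shows "limit_config t C = limit_config t D"
proof -
  have "liminf_at t (\<lambda>_. True) (\<lambda>r. state (C r)) = liminf_at t (\<lambda>_. True) (\<lambda>r. state (D r))"
    by (rule liminf_at_cong) (simp_all add: assms)
  moreover have "liminf_at t (\<lambda>_. True) (\<lambda>r. tape (C r) i x) = liminf_at t (\<lambda>_. True) (\<lambda>r. tape (D r) i x)" for i x
    by (rule liminf_at_cong) (simp_all add: assms)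
  moreover have "liminf_at t (\<lambda>r. state (C r) = q) (\<lambda>r. head (C r) i)
      = liminf_at t (\<lambda>r. state (D r) = q) (\<lambda>r. head (D r) i)" for q i
    by (rule liminf_at_cong) (simp_all add: assms)
  ultimately show ?thesis
    by (simp add: limit_config_def Let_def)
qed

lemma config_at_limit:
  assumes "t \<noteq> ord_zero" "\<not> is_suc t"
  shows "config_at p w t = limit_config t (config_at p w)"
  using assms
  by (subst config_at.simps) (auto intro: limit_config_cong)


section \<open>Decidability in bounded time\<close>

text \<open>The machine halts at time \<open>t\<close>, i.e.\ after exactly \<open>t\<close> many steps.\<close>

definition halts_at :: "program \<Rightarrow> 'o::ordinals word \<Rightarrow> 'o \<Rightarrow> bool" where
  "halts_at p w t \<longleftrightarrow> halted p (config_at p w t) \<and> (\<forall>s<t. \<not> halted p (config_at p w s))"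

text \<open>The output is the bit in cell 0 of the output tape when the machine has halted.\<close>

definition decides :: "program \<Rightarrow> 'o::ordinals word set \<Rightarrow> bool" where
  "decides p L \<longleftrightarrow> wf_program p \<and>
     (\<forall>w\<in>words. \<exists>t. halts_at p w t \<and> (tape (config_at p w t) 2 ord_zero \<longleftrightarrow> w \<in> L))"

definition decidable_in_time_times :: "'o::ordinals word set \<Rightarrow> nat \<Rightarrow> bool" where
  "decidable_in_time_times L k \<longleftrightarrow>
     (\<exists>p. decides p L \<and>
       (\<forall>w\<in>(words :: 'o word set). w \<noteq> Map.empty \<longrightarrow>
         (\<exists>t. halts_at p w t \<and> t \<le> ord_mult (word_length w) (ord_of_nat k))))"


section \<open>An instance of the class of ordinals\<close>

unbundle cardinal_syntax

typedef 'a ordinal = "Field (cardSuc |UNIV :: ('a + nat) set| )"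
  using Field_cardSuc_not_empty card_of_Card_order by blast

abbreviation ordinal_rel :: "'a itself \<Rightarrow> ('a + nat) set rel" where
  "ordinal_rel _ \<equiv> cardSuc |UNIV :: ('a + nat) set|"

lemma ordinal_rel_Card_order: "Card_order (ordinal_rel TYPE('a))"
  by (rule cardSuc_Card_order[OF card_of_Card_order])

lemma ordinal_rel_wo: "wo_rel (ordinal_rel TYPE('a))"
  unfolding wo_rel_def by (rule cardSuc_Well_order[OF card_of_Card_order])

lemma ordinal_rel_regular: "regularCard (ordinal_rel TYPE('a))"
  by (rule infinite_cardSuc_regularCard) (simp add: Field_card_of, rule card_of_Card_order)

lemma ordinal_rel_infinite: "infinite (Field (ordinal_rel TYPE('a)))"
  by (simp add: card_of_cardSuc_finite)

instantiation ordinal :: (type) linorder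
begin

definition less_eq_ordinal :: "'a ordinal \<Rightarrow> 'a ordinal \<Rightarrow> bool" where
  "x \<le> y \<longleftrightarrow> (Rep_ordinal x, Rep_ordinal y) \<in> ordinal_rel TYPE('a)"

definition less_ordinal :: "'a ordinal \<Rightarrow> 'a ordinal \<Rightarrow> bool" where
  "(x::'a ordinal) < y \<longleftrightarrow> x \<noteq> y \<and> x \<le> y"

instance
proof
  fix x y z :: "'a ordinal"
  have anti: "x = y" if "x \<le> y" "y \<le> x" for x y :: "'a ordinal"
    using that antisymD[OF wo_rel.ANTISYM[OF ordinal_rel_wo[where 'a='a]]]
    unfolding less_eq_ordinal_def Rep_ordinal_inject[symmetric] by simp
  show "(x < y) = (x \<le> y \<and> \<not> y \<le> x)"
    using anti wo_rel.REFL[OF ordinal_rel_wo[where 'a='a]] Rep_ordinal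
    by (auto simp: less_ordinal_def less_eq_ordinal_def refl_on_def)
  show "x \<le> x"
    using wo_rel.REFL[OF ordinal_rel_wo[where 'a='a]] Rep_ordinal[of x]
    by (auto simp: less_eq_ordinal_def refl_on_def)
  show "x \<le> z" if "x \<le> y" "y \<le> z"
    using that wo_rel.TRANS[OF ordinal_rel_wo[where 'a='a]]
    unfolding less_eq_ordinal_def trans_def by blast
  show "x = y" if "x \<le> y" "y \<le> x"
    using that by (rule anti)
  show "x \<le> y \<or> y \<le> x"
    using wo_rel.TOTALS[OF ordinal_rel_wo[where 'a='a]] Rep_ordinal
    by (auto simp: less_eq_ordinal_def)
qed

end

instance ordinal :: (type) wellorder
proof
  fix P :: "'a ordinal \<Rightarrow> bool" and a
  assume step: "\<And>x. (\<And>y. y < x \<Longrightarrow> P y) \<Longrightarrow> P x"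
  let ?r = "ordinal_rel TYPE('a)"
  have "wf (inv_image (?r - Id) Rep_ordinal)"
    using wo_rel.WF[OF ordinal_rel_wo] by (rule wf_inv_image)
  moreover have "inv_image (?r - Id) Rep_ordinal = {(x, y). x < y}"
    by (auto simp: inv_image_def less_ordinal_def less_eq_ordinal_def Rep_ordinal_inject)
  ultimately have "wf {(x, y :: 'a ordinal). x < y}" by simp
  then show "P a" by (induction a) (use step in blast)
qed

lemma ordinal_small_bounded:
  fixes K :: "'a ordinal set"
  assumes "|K| <o ordinal_rel TYPE('a)"
  shows "\<exists>b. \<forall>y\<in>K. y < b"
proof -
  let ?r = "ordinal_rel TYPE('a)"
  have "|Rep_ordinal ` K| <o ?r"
    using card_of_image assms by (rule ordLeq_ordLess_trans)
  then have "\<not> cofinal (Rep_ordinal ` K) ?r"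
    using ordinal_rel_regular Rep_ordinal not_ordLess_ordIso unfolding regularCard_def by blast
  then obtain a where a: "a \<in> Field ?r" "\<And>y. y \<in> K \<Longrightarrow> a = Rep_ordinal y \<or> (a, Rep_ordinal y) \<notin> ?r"
    unfolding cofinal_def by blast
  obtain b where b: "b \<in> Field ?r" "a \<noteq> b" "(a, b) \<in> ?r"
    using infinite_Card_order_limit[OF ordinal_rel_Card_order ordinal_rel_infinite a(1)] by blast
  have "Abs_ordinal a < Abs_ordinal b"
    using a(1) b by (simp add: less_ordinal_def less_eq_ordinal_def Abs_ordinal_inverse Abs_ordinal_inject)
  moreover have "y \<le> Abs_ordinal a" if "y \<in> K" for y
  proof (rule ccontr)
    assume "\<not> y \<le> Abs_ordinal a"
    then have "Abs_ordinal a < y" by simp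
    then have "Abs_ordinal a \<noteq> y" "(a, Rep_ordinal y) \<in> ?r"
      by (auto simp: less_ordinal_def less_eq_ordinal_def Abs_ordinal_inverse[OF a(1)])
    with a(2)[OF that] show False by (auto simp: Rep_ordinal_inverse)
  qed
  ultimately show ?thesis by (meson le_less_trans)
qed

instance ordinal :: (type) ordinals
proof
  let ?r = "ordinal_rel TYPE('a)"
  show bounded: "\<exists>b. \<forall>y<x. f y < b" for f :: "'a ordinal \<Rightarrow> 'a ordinal" and x
  proof -
    have "Rep_ordinal ` {..<x} \<subseteq> underS ?r (Rep_ordinal x)"
      by (auto simp: underS_def less_ordinal_def less_eq_ordinal_def Rep_ordinal_inject)
    then have "|{..<x}| \<le>o |underS ?r (Rep_ordinal x)|"
      by (intro card_of_ordLeqI[of Rep_ordinal]) (auto simp: inj_on_def Rep_ordinal_inject)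
    then have "|{..<x}| <o ?r"
      using card_of_underS[OF ordinal_rel_Card_order Rep_ordinal] by (rule ordLeq_ordLess_trans)
    then have "|f ` {..<x}| <o ?r"
      using card_of_image ordLeq_ordLess_trans by blast
    then show ?thesis using ordinal_small_bounded by blast
  qed
  show "\<exists>l x :: 'a ordinal. x < l \<and> (\<forall>y<l. \<exists>z<l. y < z)"
  proof -
    have card_range: "|range g| <o ?r" for g :: "nat \<Rightarrow> 'a ordinal"
    proof -
      have "|range g| \<le>o |UNIV :: nat set|" by (rule card_of_image)
      also have "|UNIV :: nat set| \<le>o |UNIV :: ('a + nat) set|"
        by (rule card_of_ordLeqI[of Inr]) auto
      also have "|UNIV :: ('a + nat) set| <o ?r"
        by (rule cardSuc_greater[OF card_of_Card_order])
      finally show ?thesis .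
    qed
    have "\<exists>y. x < y" for x :: "'a ordinal"
      using ordinal_small_bounded[OF card_range[of "\<lambda>_. x"]] by auto
    then obtain s :: "'a ordinal \<Rightarrow> 'a ordinal" where s: "\<And>x. x < s x" by metis
    define g where "g n = (s ^^ n) undefined" for n
    have g: "g n < g (Suc n)" for n by (simp add: g_def s)
    define l where "l = (LEAST b. \<forall>y\<in>range g. y < b)"
    have l: "\<forall>y\<in>range g. y < l"
      unfolding l_def by (rule LeastI_ex) (rule ordinal_small_bounded[OF card_range])
    have "\<exists>z<l. y < z" if "y < l" for y
    proof -
      from that have "\<not> (\<forall>z\<in>range g. z < y)"
        unfolding l_def by (rule not_less_Least)
      then obtain n where "y \<le> g n" by (auto simp: not_less)
      with g[of n] have "y < g (Suc n)" by simp
      with l show ?thesis by blast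
    qed
    with l show ?thesis by blast
  qed
qed

unbundle no cardinal_syntax

end

theory Submission
  imports Defs "HOL-Library.Infinite_Set" "HOL-Library.Nat_Bijection" "HOL-Library.Countable"
begin

text \<open>
  Words of length \<open>\<omega>\<close> separate the two time bounds. A machine never halts at a limit time, so on such a word
  the bound \<open>\<omega> \<cdot> 2\<close> forces it to halt at some time \<open>\<omega> + m\<close>: the answer depends on finitely many cells of
  a single limit configuration. The larger bound leaves room for a second infinite pass over the data collected
  in the first one.

  The language is the one accepted by a concrete machine, \<open>sweeper\<close>. It reads its input as a list
  of commands that write bits on a scratch tape and move the scratch head, and afterwards sweeps the
  scratch tape. A word of length \<open>\<omega>\<close> is accepted iff infinitely many scratch cells are \<open>0\<close> in the limit, that is,
  are not eventually constant \<open>1\<close> (\<open>swept_omega_word_iff\<close>). In both passes a head runs along the tape with the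
  end mark, so on a word of any length \<open>\<alpha>\<close> the machine halts after at most \<open>\<alpha> + 1 + \<alpha> + 1\<close> steps, which is
  at most \<open>\<alpha> \<cdot> 4\<close> unless \<open>\<alpha> = 0\<close> (\<open>swept_words_in_time\<close>).

  That the smaller bound does not suffice is shown by diagonalization. Let a machine decide the language
  within it. For a number \<open>n\<close>, consider the windows of size \<open>n\<close> on the configurations at finite times: the
  state and everything that concerns the first \<open>n\<close> cells. The set of windows that recur
  infinitely often determines the limit configuration at time \<open>\<omega>\<close> up to cells that, if \<open>n\<close> is
  large, are never visited by the finite remainder of the computation; so it determines the answer
  (\<open>same_output\<close>, \<open>MOST_avoids_gap\<close>). Being the set of recurring windows is in turn a condition of
  the form ``infinitely often'' on the run, once a time parameter is added (\<open>renewal_inf_values\<close>,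
  \<open>renewal_unique\<close>, \<open>renewal_exists\<close>). Rejection by the machine therefore means that infinitely many codes \<open>j\<close> satisfy
  a condition that holds infinitely often along the run, and acceptance means that only finitely many do.

  This has precisely the form of membership in the language. Since a run depends causally
  on the input, there is a word whose commands write, into scratch cell \<open>j\<close> and with a suitable delay, whether the
  condition with code \<open>j\<close> holds along the run of the machine on this very word (\<open>diagonal_sequence\<close>). The word
  belongs to the language iff the machine rejects it.
\<close>


section \<open>Finite successors and the next limit\<close>

abbreviation ord_plus :: "'o::ordinals \<Rightarrow> nat \<Rightarrow> 'o" (infixl \<open>\<oplus>\<close> 65) where
  "t \<oplus> n \<equiv> (ord_suc ^^ n) t"

abbreviation fin :: "nat \<Rightarrow> 'o::ordinals" where
  "fin n \<equiv> ord_zero \<oplus> n"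

lemma less_ord_suc_iff [simp]: "x < ord_suc y \<longleftrightarrow> x \<le> y" for x y :: "'o::ordinals"
  by (metis not_less ord_suc_le_iff)

text \<open>
  This is \<open>t + \<omega>\<close>. The direct description as a least upper bound of finite successors makes
  limit steps of a run accessible to ordinary infinite sequences, without ordinal arithmetic.
\<close>

definition next_limit :: "'o::ordinals \<Rightarrow> 'o" where
  "next_limit t = (LEAST l. \<forall>n. t \<oplus> n < l)"

abbreviation omega :: "'o::ordinals" where
  "omega \<equiv> next_limit ord_zero"

lemma ord_plus_less: "m < n \<Longrightarrow> t \<oplus> m < (t \<oplus> n :: 'o::ordinals)"
  by (rule lift_Suc_mono_less) (simp_all add: less_ord_suc)

lemma ord_plus_less_iff [simp]: "t \<oplus> m < t \<oplus> n \<longleftrightarrow> m < n" for t :: "'o::ordinals"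
  by (metis ord_plus_less linorder_neqE_nat not_less_iff_gr_or_eq)

lemma ord_plus_le_iff [simp]: "t \<oplus> m \<le> t \<oplus> n \<longleftrightarrow> m \<le> n" for t :: "'o::ordinals"
  by (meson ord_plus_less_iff not_less)

lemma ord_plus_eq_iff [simp]: "t \<oplus> m = t \<oplus> n \<longleftrightarrow> m = n" for t :: "'o::ordinals"
  by (simp add: order.eq_iff)

lemma le_ord_plus: "t \<le> t \<oplus> n" for t :: "'o::ordinals"
  using ord_plus_le_iff[of 0 t n] by simp

text \<open>
  Replacement applies to functions on the predecessors of an ordinal; the given limit ordinal has all
  finite ordinals among its predecessors, so a sequence indexed by them is bounded.
\<close>

lemma ord_plus_bounded: "\<exists>b. \<forall>n. t \<oplus> n < (b :: 'o::ordinals)"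
proof -
  obtain l x :: 'o where l: "x < l" "\<forall>y<l. \<exists>z<l. y < z"
    using limit_ordinal_exists by blast
  have fin_less: "fin n < l" for n
  proof (induction n)
    case 0
    show ?case using l(1) le_less_trans[OF ord_zero_le] by simp
  next
    case (Suc n)
    then obtain z where "z < l" "fin n < z" using l(2) by blast
    then have "fin (Suc n) \<le> z" by (simp add: ord_suc_le_iff)
    with \<open>z < l\<close> show ?case by (rule order.strict_trans1[rotated])
  qed
  obtain b where b: "\<forall>y<l. t \<oplus> (THE n. y = fin n) < b"
    using replacement[of l "\<lambda>y. t \<oplus> (THE n. y = fin n)"] by blast
  have "t \<oplus> n < b" for n
    using b fin_less[of n] by fastforce
  then show ?thesis by blast
qed

lemma ord_plus_less_next_limit [simp]: "t \<oplus> n < next_limit t" for t :: "'o::ordinals"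
  unfolding next_limit_def using LeastI_ex[OF ord_plus_bounded[of t]] by blast

lemma less_next_limit [simp]: "t < next_limit t" for t :: "'o::ordinals"
  using ord_plus_less_next_limit[where n = 0] by simp

lemma less_next_limitD:
  fixes t :: "'o::ordinals"
  assumes "s < next_limit t"
  shows "\<exists>n. s \<le> t \<oplus> n"
  using not_less_Least[OF assms[unfolded next_limit_def]] by (auto simp: not_less)

lemma between_ord_plus: "t \<le> s \<Longrightarrow> s \<le> t \<oplus> n \<Longrightarrow> \<exists>k\<le>n. s = t \<oplus> k" for t :: "'o::ordinals"
proof (induction n)
  case (Suc n)
  show ?case
  proof (cases "s \<le> t \<oplus> n")
    case True
    with Suc show ?thesis by (meson le_Suc_eq)
  next
    case False
    then have "ord_suc (t \<oplus> n) \<le> s" by (simp add: ord_suc_le_iff)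
    with Suc.prems(2) show ?thesis by (intro exI[of _ "Suc n"]) simp
  qed
qed simp

lemma less_next_limit_iff: "s < next_limit t \<longleftrightarrow> s < t \<or> (\<exists>n. s = t \<oplus> n)" for t :: "'o::ordinals"
proof
  assume "s < next_limit t"
  then obtain n where "s \<le> t \<oplus> n" using less_next_limitD by blast
  then show "s < t \<or> (\<exists>n. s = t \<oplus> n)" using between_ord_plus[of t s n] by fastforce
next
  assume "s < t \<or> (\<exists>n. s = t \<oplus> n)"
  then show "s < next_limit t" using less_trans[OF _ less_next_limit[of t]] by auto
qed

lemma less_omega_iff: "s < omega \<longleftrightarrow> (\<exists>n. s = fin n)" for s :: "'o::ordinals"
  unfolding less_next_limit_iff using leD[OF ord_zero_le[of s]] by blast

lemma next_limit_neq_zero [simp]: "next_limit t \<noteq> (ord_zero :: 'o::ordinals)"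
  by (metis less_next_limit not_less ord_zero_le)

lemma next_limit_not_suc [simp]: "\<not> is_suc (next_limit t :: 'o::ordinals)"
proof
  assume "is_suc (next_limit t)"
  then obtain y where y: "next_limit t = ord_suc y" by (auto simp: is_suc_def)
  then have "y < next_limit t" by (simp add: less_ord_suc)
  then obtain n where "y \<le> t \<oplus> n" using less_next_limitD by blast
  then have "next_limit t \<le> t \<oplus> Suc n"
    unfolding y by (simp add: ord_suc_le_iff le_less_trans[OF _ less_ord_suc])
  with ord_plus_less_next_limit[where n = "Suc n" and t = t] show False by (meson not_less)
qed

lemma limit_suc_less:
  assumes "\<not> is_suc t" "s < t"
  shows "ord_suc s < (t :: 'o::ordinals)"
  using assms by (metis is_suc_ord_suc ord_suc_le_iff order.not_eq_order_implies_strict)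

lemma ord_cases [case_names zero suc limit]:
  obtains "t = (ord_zero :: 'o::ordinals)" | s where "t = ord_suc s" | "t \<noteq> ord_zero" "\<not> is_suc t"
  by (auto simp: is_suc_def)

lemma move_head_le:
  fixes x :: "'o::ordinals"
  shows "move_head Left x \<le> x"
  using ord_pred_less[of x] by auto

text \<open>
  The finite successors of \<open>t\<close> are cofinal in \<open>t + \<omega>\<close>. This turns every inferior limit at such a time
  into a statement about almost all, or infinitely many, natural numbers.
\<close>

lemma MOST_next_limit:
  fixes t :: "'o::ordinals"
  shows "(\<exists>s<next_limit t. \<forall>r. s \<le> r \<and> r < next_limit t \<longrightarrow> Q r) \<longleftrightarrow> (MOST n. Q (t \<oplus> n))"
proof
  assume "\<exists>s<next_limit t. \<forall>r. s \<le> r \<and> r < next_limit t \<longrightarrow> Q r"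
  then obtain s where s: "s < next_limit t" "\<And>r. s \<le> r \<Longrightarrow> r < next_limit t \<Longrightarrow> Q r" by blast
  obtain m where "s \<le> t \<oplus> m" using less_next_limitD[OF s(1)] by blast
  then have "Q (t \<oplus> n)" if "m \<le> n" for n
    using that by (intro s(2)) (auto intro: order_trans)
  then show "MOST n. Q (t \<oplus> n)" unfolding MOST_nat_le by blast
next
  assume "MOST n. Q (t \<oplus> n)"
  then obtain m where m: "\<And>n. m \<le> n \<Longrightarrow> Q (t \<oplus> n)" unfolding MOST_nat_le by blast
  have "Q r" if ge: "t \<oplus> m \<le> r" and less: "r < next_limit t" for r
  proof -
    have "t \<le> r" using le_ord_plus ge by (rule order_trans)
    then obtain n where n: "r = t \<oplus> n"
      using less leD unfolding less_next_limit_iff by blast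
    then show ?thesis using m[of n] ge by simp
  qed
  then show "\<exists>s<next_limit t. \<forall>r. s \<le> r \<and> r < next_limit t \<longrightarrow> Q r"
    by (intro exI[of _ "t \<oplus> m"]) simp
qed

lemma INFM_next_limit:
  fixes t :: "'o::ordinals"
  shows "(\<forall>s<next_limit t. \<exists>r. s \<le> r \<and> r < next_limit t \<and> Q r) \<longleftrightarrow> (INFM n. Q (t \<oplus> n))"
  using MOST_next_limit[of t "\<lambda>r. \<not> Q r"] unfolding not_INFM[symmetric] by blast


section \<open>Inferior limits\<close>

lemma liminf_at_le:
  fixes f :: "'o::ordinals \<Rightarrow> 'b::wellorder"
  assumes "\<And>s. s < t \<Longrightarrow> \<exists>r. s \<le> r \<and> r < t \<and> P r \<and> f r \<le> u"
  shows "liminf_at t P f \<le> u"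
  unfolding liminf_at_def
proof (rule Least_le, intro allI impI)
  fix s assume "s < t"
  with assms obtain r where "s \<le> r" "r < t" "P r" "f r \<le> u" by blast
  then have "(LEAST v. \<exists>r. s \<le> r \<and> r < t \<and> P r \<and> v = f r) \<le> f r"
    by (intro Least_le) blast
  also note \<open>f r \<le> u\<close>
  finally show "(LEAST v. \<exists>r. s \<le> r \<and> r < t \<and> P r \<and> v = f r) \<le> u" .
qed

text \<open>
  An inferior limit is a supremum of minima, and the minimum over each final segment is attained.
  Together with \<open>liminf_at_le\<close> this characterizes the inferior limit of well-ordered values;
  boundedness guarantees that the supremum exists.
\<close>

lemma liminf_at_often_le_limit:
  fixes f :: "'o::ordinals \<Rightarrow> 'b::wellorder"
  assumes bounded: "\<And>s. s < t \<Longrightarrow> \<exists>r. s \<le> r \<and> r < t \<and> P r \<and> f r \<le> u" and "s < t"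
  shows "\<exists>r. s \<le> r \<and> r < t \<and> P r \<and> f r \<le> liminf_at t P f"
proof -
  define Q where "Q s v \<longleftrightarrow> (\<exists>r. s \<le> r \<and> r < t \<and> P r \<and> v = f r)" for s v
  have "\<forall>s<t. Least (Q s) \<le> u"
  proof (intro allI impI)
    fix s assume "s < t"
    with bounded obtain r where "Q s (f r)" "f r \<le> u" unfolding Q_def by blast
    then show "Least (Q s) \<le> u" by (meson Least_le order_trans)
  qed
  then have "\<forall>s<t. Least (Q s) \<le> (LEAST u. \<forall>s<t. Least (Q s) \<le> u)" by (rule LeastI)
  then have le: "Least (Q s) \<le> liminf_at t P f"
    using \<open>s < t\<close> unfolding liminf_at_def Q_def by blast
  have "\<exists>v. Q s v" using bounded[OF \<open>s < t\<close>] unfolding Q_def by blast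
  then have "Q s (Least (Q s))" by (rule LeastI_ex)
  then obtain r where "s \<le> r" "r < t" "P r" "Least (Q s) = f r" unfolding Q_def by blast
  with le show ?thesis by auto
qed

lemma liminf_at_eqI:
  fixes f :: "'o::ordinals \<Rightarrow> 'b::wellorder"
  assumes often: "\<And>s. s < t \<Longrightarrow> \<exists>r. s \<le> r \<and> r < t \<and> P r \<and> f r \<le> u"
    and eventually: "\<And>v. v < u \<Longrightarrow> \<exists>s<t. \<forall>r. s \<le> r \<and> r < t \<and> P r \<longrightarrow> v < f r"
  shows "liminf_at t P f = u"
proof (rule ccontr)
  assume "liminf_at t P f \<noteq> u"
  moreover have "liminf_at t P f \<le> u" using often by (rule liminf_at_le)
  ultimately have "liminf_at t P f < u" by simp
  then obtain s where "s < t" and s: "\<forall>r. s \<le> r \<and> r < t \<and> P r \<longrightarrow> liminf_at t P f < f r"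
    using eventually by blast
  with liminf_at_often_le_limit[OF often \<open>s < t\<close>] show False by (meson leD)
qed

lemma liminf_at_bool:
  fixes f :: "'o::ordinals \<Rightarrow> bool"
  shows "liminf_at t (\<lambda>_. True) f \<longleftrightarrow> (\<exists>s<t. \<forall>r. s \<le> r \<and> r < t \<longrightarrow> f r)"
proof -
  have Least_bool: "Least Q \<longleftrightarrow> \<not> Q False" if "\<exists>v. Q v" for Q :: "bool \<Rightarrow> bool"
  proof (cases "Q False")
    case True
    then have "Least Q = False" by (intro Least_equality) auto
    with True show ?thesis by simp
  next
    case False
    with that have "Q True" by (simp add: ex_bool_eq)
    with False have "Least Q = True" by (intro Least_equality) (metis (full_types) order_refl)+
    with False show ?thesis by simp
  qed
  have inner: "(LEAST v. \<exists>r. s \<le> r \<and> r < t \<and> True \<and> v = f r) \<longleftrightarrow> (\<forall>r. s \<le> r \<and> r < t \<longrightarrow> f r)"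
    if "s < t" for s
    by (subst Least_bool) (use that in auto)
  show ?thesis
    unfolding liminf_at_def by (subst Least_bool) (use inner in auto)
qed

text \<open>
  A supremum of boundedly many natural numbers is attained, so the limit state is a state that
  has been visited at arbitrarily late times.
\<close>

lemma liminf_at_nat:
  fixes f :: "'o::ordinals \<Rightarrow> nat"
  assumes "s1 < t" and bounded: "\<And>r. s1 \<le> r \<Longrightarrow> r < t \<Longrightarrow> f r \<le> B" and "s < t"
  shows "\<exists>r. s \<le> r \<and> r < t \<and> f r = liminf_at t (\<lambda>_. True) f"
proof -
  define q where "q = liminf_at t (\<lambda>_. True) f"
  define m where "m s = (LEAST v. \<exists>r. s \<le> r \<and> r < t \<and> True \<and> v = f r)" for s
  have q: "q = (LEAST u. \<forall>s<t. m s \<le> u)"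
    unfolding q_def liminf_at_def m_def ..
  have att: "\<exists>r. s \<le> r \<and> r < t \<and> True \<and> m s = f r" if "s < t" for s
    unfolding m_def by (rule LeastI_ex) (use that in blast)
  have le: "m s \<le> f r" if "s \<le> r" "r < t" for s r
    unfolding m_def by (rule Least_le) (use that in blast)
  have mono: "m s \<le> m s'" if "s \<le> s'" "s' < t" for s s'
    using att[OF that(2)] le that by (metis order_trans)
  have "\<forall>s<t. m s \<le> B"
  proof (intro allI impI)
    fix s assume "s < t"
    then have "m s \<le> f (max s s1)" using \<open>s1 < t\<close> by (intro le) simp_all
    also have "\<dots> \<le> B" using \<open>s < t\<close> \<open>s1 < t\<close> by (intro bounded) simp_all
    finally show "m s \<le> B" .
  qed
  then have up: "\<forall>s<t. m s \<le> q" unfolding q by (rule LeastI)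
  have "\<exists>s<t. m s = q"
  proof (rule ccontr)
    assume neg: "\<not> (\<exists>s<t. m s = q)"
    with up have less: "\<forall>s<t. m s < q" by (meson order.not_eq_order_implies_strict)
    with \<open>s1 < t\<close> have "0 < q" by (metis gr_zeroI not_less0)
    with less have "\<forall>s<t. m s \<le> q - 1" by auto
    then have "q \<le> q - 1" unfolding q by (rule Least_le)
    with \<open>0 < q\<close> show False by simp
  qed
  then obtain s0 where s0: "s0 < t" "m s0 = q" by blast
  have "max s s0 < t" using \<open>s < t\<close> s0 by simp
  moreover have "m (max s s0) = q"
    using up mono[of s0 "max s s0"] s0(2) calculation by (simp add: order.antisym)
  ultimately show ?thesis using att[of "max s s0"] unfolding q_def by auto
qed

lemma liminf_at_eventually_const:
  fixes f :: "'o::ordinals \<Rightarrow> 'b::wellorder"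
  assumes "s < t" "\<And>r. s \<le> r \<Longrightarrow> r < t \<Longrightarrow> P r \<and> f r = c"
  shows "liminf_at t P f = c"
proof (rule liminf_at_eqI)
  fix s' assume "s' < t"
  then show "\<exists>r. s' \<le> r \<and> r < t \<and> P r \<and> f r \<le> c"
    using assms by (intro exI[of _ "max s s'"]) auto
qed (use assms in blast)

lemma liminf_at_bool_eventually_const:
  fixes f :: "'o::ordinals \<Rightarrow> bool"
  assumes "s < t" "\<And>r. s \<le> r \<Longrightarrow> r < t \<Longrightarrow> f r = c"
  shows "liminf_at t (\<lambda>_. True) f = c"
proof -
  have "f r = c" if "s \<le> r" "r < t" for r using assms that by blast
  then have "(\<forall>r. max s s' \<le> r \<and> r < t \<longrightarrow> f r) \<longleftrightarrow> c" if "s' < t" for s'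
    using that assms(1) by (auto intro: exI[of _ "max s s'"])
  then show ?thesis unfolding liminf_at_bool
    using assms(1) by (smt (verit) max_less_iff_conj max.bounded_iff)
qed

lemma liminf_next_limit_bool:
  "liminf_at (next_limit t) (\<lambda>_. True) f \<longleftrightarrow> (MOST n. f (t \<oplus> n))" for t :: "'o::ordinals"
  unfolding liminf_at_bool MOST_next_limit ..

lemma liminf_next_limit_eqI:
  fixes f :: "'o::ordinals \<Rightarrow> 'b::wellorder"
  assumes "INFM n. P (t \<oplus> n) \<and> f (t \<oplus> n) \<le> u"
    and "\<And>v. v < u \<Longrightarrow> MOST n. P (t \<oplus> n) \<longrightarrow> v < f (t \<oplus> n)"
  shows "liminf_at (next_limit t) P f = u"
proof (rule liminf_at_eqI)
  show "\<exists>r. s \<le> r \<and> r < next_limit t \<and> P r \<and> f r \<le> u" if "s < next_limit t" for s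
    using assms(1) that INFM_next_limit[of t "\<lambda>r. P r \<and> f r \<le> u"] by blast
  show "\<exists>s<next_limit t. \<forall>r. s \<le> r \<and> r < next_limit t \<and> P r \<longrightarrow> v < f r" if "v < u" for v
    using assms(2)[OF that] MOST_next_limit[of t "\<lambda>r. P r \<longrightarrow> v < f r"] by blast
qed


text \<open>
  A bounded inferior limit is determined by the bounds below which the values return infinitely
  often. Two runs that share these bounds therefore have the same limit.
\<close>

lemma liminf_next_limit_le_iff:
  fixes f :: "'o::ordinals \<Rightarrow> 'b::wellorder"
  assumes "INFM n. P (t \<oplus> n) \<and> f (t \<oplus> n) \<le> u"
  shows "liminf_at (next_limit t) P f \<le> v \<longleftrightarrow> (INFM n. P (t \<oplus> n) \<and> f (t \<oplus> n) \<le> v)"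
proof
  have bounded: "\<exists>r. s \<le> r \<and> r < next_limit t \<and> P r \<and> f r \<le> u" if "s < next_limit t" for s
    using assms that INFM_next_limit[of t "\<lambda>r. P r \<and> f r \<le> u"] by blast
  assume "liminf_at (next_limit t) P f \<le> v"
  then have "\<exists>r. s \<le> r \<and> r < next_limit t \<and> P r \<and> f r \<le> v" if "s < next_limit t" for s
    using liminf_at_often_le_limit[OF bounded that] by (meson order_trans)
  then show "INFM n. P (t \<oplus> n) \<and> f (t \<oplus> n) \<le> v"
    using INFM_next_limit[of t "\<lambda>r. P r \<and> f r \<le> v"] by blast
next
  assume "INFM n. P (t \<oplus> n) \<and> f (t \<oplus> n) \<le> v"
  then show "liminf_at (next_limit t) P f \<le> v"
    using INFM_next_limit[of t "\<lambda>r. P r \<and> f r \<le> v"] by (intro liminf_at_le) blast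
qed

section \<open>Ordinal sums and products\<close>

lemma ord_add_ex: "\<exists>x. a \<le> x \<and> (\<forall>c\<in>{..<b}. ord_add a c < x)" for a b :: "'o::ordinals"
proof -
  obtain x where "\<forall>c<b. ord_add a c < x" using replacement[of b "ord_add a"] by blast
  then show ?thesis by (intro exI[of _ "max a x"]) (auto intro: less_le_trans)
qed

lemma le_ord_add: "a \<le> ord_add a b" for a b :: "'o::ordinals"
  using LeastI_ex[OF ord_add_ex[of a b]] by (subst ord_add.simps) blast

lemma ord_add_strict_mono: "c < b \<Longrightarrow> ord_add a c < ord_add a b" for a b :: "'o::ordinals"
  using LeastI_ex[OF ord_add_ex[of a b]] by (subst (2) ord_add.simps) blast

lemma ord_add_mono_right: "c \<le> b \<Longrightarrow> ord_add a c \<le> ord_add a b" for a b :: "'o::ordinals"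
  using ord_add_strict_mono by (metis order.order_iff_strict)

lemma ord_add_leI: "a \<le> x \<Longrightarrow> (\<And>c. c < b \<Longrightarrow> ord_add a c < x) \<Longrightarrow> ord_add a b \<le> x"
  for a b :: "'o::ordinals"
  by (subst ord_add.simps) (rule Least_le, blast)

lemma le_ord_add_right: "b \<le> ord_add a b" for a b :: "'o::ordinals"
proof (induction b rule: less_induct)
  case (less b)
  have "c < ord_add a b" if "c < b" for c
    using less[OF that] ord_add_strict_mono[OF that] by (rule le_less_trans)
  then show ?case by (meson not_less order.irrefl)
qed

lemma ord_add_mono_left: "a \<le> a' \<Longrightarrow> ord_add a b \<le> ord_add a' b" for a b :: "'o::ordinals"
proof (induction b rule: less_induct)
  case (less b)
  show ?case
  proof (rule ord_add_leI)
    show "a \<le> ord_add a' b" using less.prems le_ord_add by (rule order_trans)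
    show "ord_add a c < ord_add a' b" if "c < b" for c
      using less.IH[OF that less.prems] ord_add_strict_mono[OF that] by (rule le_less_trans)
  qed
qed

lemma ord_add_zero [simp]: "ord_add a ord_zero = a" for a :: "'o::ordinals"
proof (rule order.antisym[OF ord_add_leI le_ord_add])
  show "ord_add a c < a" if "c < ord_zero" for c
    using that leD[OF ord_zero_le] by blast
qed simp

lemma ord_add_suc [simp]: "ord_add a (ord_suc b) = ord_suc (ord_add a b)" for a b :: "'o::ordinals"
proof (rule order.antisym[OF ord_add_leI])
  show "a \<le> ord_suc (ord_add a b)" using le_ord_add less_ord_suc by (meson less_imp_le order_trans)
  show "ord_add a c < ord_suc (ord_add a b)" if "c < ord_suc b" for c
    using that ord_add_mono_right[of c b a] less_ord_suc[of "ord_add a b"]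
    by (metis le_less_trans not_less ord_suc_le_iff)
  show "ord_suc (ord_add a b) \<le> ord_add a (ord_suc b)"
    by (simp add: ord_suc_le_iff ord_add_strict_mono less_ord_suc)
qed

lemma ord_add_zero_left [simp]: "ord_add ord_zero a = a" for a :: "'o::ordinals"
proof (induction a rule: less_induct)
  case (less a)
  have "ord_add ord_zero a \<le> a" by (rule ord_add_leI) (simp_all add: less)
  then show ?case using le_ord_add_right by (rule order.antisym)
qed

lemma ord_add_limit:
  fixes a b :: "'o::ordinals"
  assumes "b \<noteq> ord_zero" "\<not> is_suc b"
  shows "\<not> is_suc (ord_add a b)" and "\<And>s. s < ord_add a b \<Longrightarrow> \<exists>c<b. s < ord_add a c"
proof -
  show *: "\<exists>c<b. s < ord_add a c" if less: "s < ord_add a b" for s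
  proof (rule ccontr)
    assume neg: "\<not> (\<exists>c<b. s < ord_add a c)"
    have "ord_zero < b" using assms(1) by (simp add: order.not_eq_order_implies_strict)
    with neg have "a \<le> s" by fastforce
    moreover have "ord_add a c < s" if "c < b" for c
    proof -
      have "ord_suc (ord_add a c) \<le> s"
        using neg limit_suc_less[OF assms(2) that] by (metis not_less ord_add_suc)
      then show ?thesis by (simp add: ord_suc_le_iff)
    qed
    ultimately have "ord_add a b \<le> s" by (rule ord_add_leI)
    with less show False by simp
  qed
  show "\<not> is_suc (ord_add a b)"
  proof
    assume "is_suc (ord_add a b)"
    then obtain y where y: "ord_add a b = ord_suc y" by (auto simp: is_suc_def)
    then obtain c where "c < b" "y < ord_add a c" using *[of y] less_ord_suc by metis
    then have "ord_add a b \<le> ord_add a c" by (simp add: y ord_suc_le_iff)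
    with ord_add_strict_mono[OF \<open>c < b\<close>, of a] show False by simp
  qed
qed

text \<open>
  Sums with a fixed left summand leave no holes. So a time in a phase that starts at time \<open>t\<close>
  is \<open>t\<close> plus the time spent in the phase.
\<close>

lemma ord_add_split:
  fixes t r s :: "'o::ordinals"
  assumes "t \<le> r" "r < ord_add t s"
  shows "\<exists>c<s. r = ord_add t c"
proof -
  define c where "c = (LEAST c. r \<le> ord_add t c)"
  have c: "r \<le> ord_add t c" unfolding c_def by (rule LeastI[of _ s]) (use assms in simp)
  have least: "ord_add t d < r" if "d < c" for d
    using not_less_Least[OF that[unfolded c_def]] by simp
  have "r = ord_add t c"
  proof (cases c rule: ord_cases)
    case zero
    with c assms(1) show ?thesis by simp
  next
    case (suc d)
    then have "ord_suc (ord_add t d) \<le> r" by (simp add: ord_suc_le_iff least less_ord_suc)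
    with c suc show ?thesis by simp
  next
    case limit
    show ?thesis
    proof (rule ccontr)
      assume "r \<noteq> ord_add t c"
      with c have "r < ord_add t c" by simp
      then obtain d where "d < c" "r < ord_add t d" using ord_add_limit(2)[OF limit] by blast
      with least[of d] show False by simp
    qed
  qed
  moreover have "c < s"
    using assms(2) calculation ord_add_mono_right[of s c t] by (meson leD leI)
  ultimately show ?thesis by blast
qed

lemma ord_add_omega_le:
  fixes t :: "'o::ordinals"
  shows "ord_add t omega \<le> next_limit t"
proof (rule ord_add_leI)
  show "ord_add t c < next_limit t" if c: "c < omega" for c
  proof -
    obtain n where n: "c = fin n" using c unfolding less_omega_iff by blast
    have "ord_add t (fin m) = t \<oplus> m" for m by (induction m) simp_all
    with n show ?thesis by (simp only: ord_plus_less_next_limit)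
  qed
  show "t \<le> next_limit t" using less_next_limit by (rule less_imp_le)
qed

lemma ord_mult_ex: "\<exists>x. \<forall>c\<in>{..<b}. ord_add (ord_mult a c) a \<le> x" for a b :: "'o::ordinals"
  using replacement[of b "\<lambda>c. ord_add (ord_mult a c) a"] by (blast intro: less_imp_le)

lemma ord_mult_ge:
  fixes a b :: "'o::ordinals"
  assumes "c < b"
  shows "ord_add (ord_mult a c) a \<le> ord_mult a b"
proof -
  have "\<forall>c\<in>{..<b}. ord_add (ord_mult a c) a \<le> ord_mult a b"
    using LeastI_ex[OF ord_mult_ex[of b a]] unfolding ord_mult.simps[of a b, symmetric] .
  with assms show ?thesis by simp
qed

lemma ord_mult_suc_ge: "ord_add (ord_mult a c) a \<le> ord_mult a (ord_suc c)" for a :: "'o::ordinals"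
  by (rule ord_mult_ge) (rule less_ord_suc)

lemma ord_mult_zero [simp]: "ord_mult a ord_zero = ord_zero" for a :: "'o::ordinals"
  by (subst ord_mult.simps, rule Least_equality) (auto simp: leD[OF ord_zero_le])

lemma ord_mult_leI: "(\<And>c. c < b \<Longrightarrow> ord_add (ord_mult a c) a \<le> x) \<Longrightarrow> ord_mult a b \<le> x"
  for a b :: "'o::ordinals"
  by (subst ord_mult.simps) (rule Least_le, blast)

text \<open>
  In the supremum defining the product, the clauses for \<open>d < c\<close> are dominated by the clause for \<open>c\<close>,
  as \<open>a \<cdot> d\<close> increases with \<open>d\<close>.
\<close>

lemma ord_mult_suc_le:
  fixes a c :: "'o::ordinals"
  shows "ord_mult a (ord_suc c) \<le> ord_add (ord_mult a c) a"
proof (rule ord_mult_leI)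
  fix d assume "d < ord_suc c"
  then have "d \<le> c" by (metis not_less ord_suc_le_iff)
  then have "ord_mult a d \<le> ord_mult a c"
    by (intro ord_mult_leI ord_mult_ge) simp
  then show "ord_add (ord_mult a d) a \<le> ord_add (ord_mult a c) a" by (rule ord_add_mono_left)
qed

lemma ord_mult_two_le: "ord_mult a (ord_of_nat 2) \<le> ord_add a a" for a :: "'o::ordinals"
proof -
  have two: "ord_of_nat 2 = ord_suc (ord_suc (ord_zero :: 'o))"
    by (simp add: ord_of_nat_def numeral_2_eq_2)
  have "ord_mult a (ord_suc ord_zero) \<le> a"
    using ord_mult_suc_le[of a ord_zero] by simp
  then have "ord_add (ord_mult a (ord_suc ord_zero)) a \<le> ord_add a a" by (rule ord_add_mono_left)
  with ord_mult_suc_le show ?thesis unfolding two by (rule order_trans)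
qed

lemma ord_mult_four_ge:
  "ord_add (ord_add (ord_add a a) a) a \<le> ord_mult a (ord_of_nat 4)" for a :: "'o::ordinals"
proof -
  have four: "ord_of_nat 4 = ord_suc (ord_suc (ord_suc (ord_suc (ord_zero :: 'o))))"
    by (simp add: ord_of_nat_def eval_nat_numeral)
  have step: "ord_add x a \<le> ord_mult a (ord_suc c)" if "x \<le> ord_mult a c" for x c
    using ord_add_mono_left[OF that] ord_mult_suc_ge by (rule order_trans)
  have "a \<le> ord_mult a (ord_suc ord_zero)" using ord_mult_suc_ge[of a ord_zero] by simp
  then show ?thesis unfolding four by (intro step)
qed


section \<open>Halting\<close>

text \<open>
  At limit times a run that has become constant keeps its configuration, because all inferior limits
  are limits of eventually constant functions.
\<close>

lemma halted_stays:
  fixes w :: "'o::ordinals word"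
  assumes "halted p (config_at p w s)" "s \<le> t"
  shows "config_at p w t = config_at p w s"
  using assms(2)
proof (induction t rule: less_induct)
  case (less t)
  show ?case
  proof (cases "s = t")
    case False
    with less.prems have st: "s < t" by simp
    show ?thesis
    proof (cases t rule: ord_cases)
      case zero
      with st leD[OF ord_zero_le] show ?thesis by blast
    next
      case (suc t')
      then have "s \<le> t'" using st by (metis not_less ord_suc_le_iff)
      then have "config_at p w t' = config_at p w s" by (intro less.IH) (simp_all add: suc less_ord_suc)
      with assms(1) show ?thesis unfolding suc by (simp add: config_at_suc next_config_def)
    next
      case limit
      have const: "config_at p w r = config_at p w s" if "s \<le> r" "r < t" for r
        using less.IH that by blast
      have q: "liminf_at t (\<lambda>_. True) (\<lambda>r. state (config_at p w r)) = state (config_at p w s)"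
        by (rule liminf_at_eventually_const[OF st]) (metis const)
      have h: "liminf_at t (\<lambda>r. state (config_at p w r) = state (config_at p w s))
          (\<lambda>r. head (config_at p w r) i) = head (config_at p w s) i" for i
        by (rule liminf_at_eventually_const[OF st]) (metis const)
      have b: "liminf_at t (\<lambda>_. True) (\<lambda>r. tape (config_at p w r) i x) = tape (config_at p w s) i x" for i x
        by (rule liminf_at_bool_eventually_const[OF st]) (metis const)
      show ?thesis
        unfolding config_at_limit[OF limit] limit_config_def Let_def q h b by simp
    qed
  qed simp
qed

text \<open>
  Halting is entering a state that is too large, and the limit state is one of the earlier states.
  So every machine halts at time \<open>0\<close> or at a successor time.
\<close>

lemma not_halted_at_limit:
  fixes w :: "'o::ordinals word"
  assumes "t \<noteq> ord_zero" "\<not> is_suc t" "\<And>r. r < t \<Longrightarrow> \<not> halted p (config_at p w r)"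
  shows "\<not> halted p (config_at p w t)"
proof -
  have pos: "ord_zero < t" using assms(1) by (simp add: order.not_eq_order_implies_strict)
  have "\<exists>r. ord_zero \<le> r \<and> r < t \<and> state (config_at p w r)
      = liminf_at t (\<lambda>_. True) (\<lambda>r. state (config_at p w r))"
    by (rule liminf_at_nat[OF pos, where B = "n_states p"])
       (use assms(3) pos in \<open>auto simp: halted_def not_le less_imp_le\<close>)
  then obtain r where "r < t" "state (config_at p w r) = state (config_at p w t)"
    by (auto simp: config_at_limit[OF assms(1,2)] limit_config_def Let_def)
  with assms(3)[of r] show ?thesis by (simp add: halted_def)
qed

lemma halts_at_unique: "halts_at p w s \<Longrightarrow> halts_at p w t \<Longrightarrow> s = t"
  unfolding halts_at_def by (meson linorder_neqE)

lemma halts_at_least: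
  assumes "halted p (config_at p w s)"
  shows "\<exists>t\<le>s. halts_at p w t"
proof -
  let ?t = "LEAST t. halted p (config_at p w t)"
  have "halts_at p w ?t"
    unfolding halts_at_def using LeastI[of "\<lambda>t. halted p (config_at p w t)", OF assms] not_less_Least by blast
  moreover have "?t \<le> s" by (rule Least_le) (rule assms)
  ultimately show ?thesis by blast
qed

section \<open>A machine that rewrites and then sweeps a scratch tape\<close>

text \<open>
  States \<open>0\<close> and \<open>1\<close> read the input in pairs of bits: the first is written into the scanned cell of
  the scratch tape 3, the second says in which direction the scratch head then moves. At the end of
  the input, states \<open>2\<close> and \<open>3\<close> take over and sweep the scratch tape to the right; the state is
  \<open>2\<close> just after a \<open>0\<close> was read. By the rule for limit states, the sweep of an
  infinite tape ends in state \<open>2\<close> iff infinitely many zeros were read. The sweep needs no measure of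
  its own: the head on the marker tape goes along and finds the end mark again at the right time.
  
  When the first phase ends, one step to the left brings both heads to finite positions if the input has
  length \<open>\<omega>\<close>, because moving left from a limit cell leads to cell \<open>0\<close>. Where the sweep starts among the
  finite positions does not influence whether it meets infinitely many zeros.
\<close>

definition sweeper :: program where
  "sweeper = \<lparr>n_tapes = 4, n_states = 4, instr = (\<lambda>q bs.
     if q < 2 then
       if bs ! 1 then (2, [(bs ! 0, Stay), (bs ! 1, Left), (bs ! 2, Stay), (bs ! 3, Left)])
       else if q = 0 then (1, [(bs ! 0, Right), (bs ! 1, Right), (bs ! 2, Stay), (bs ! 0, Stay)])
       else (0, [(bs ! 0, Right), (bs ! 1, Right), (bs ! 2, Stay), (bs ! 3, if bs ! 0 then Right else Left)])
     else
       if bs ! 1 then (4, [(bs ! 0, Stay), (bs ! 1, Stay), (q = 2, Stay), (bs ! 3, Stay)])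
       else (if bs ! 3 then 3 else 2, [(bs ! 0, Stay), (bs ! 1, Right), (bs ! 2, Stay), (bs ! 3, Right)]))\<rparr>"

\<comment> \<open>The numeral \<open>1\<close> is the name of the marker tape and must not be rewritten to \<open>Suc 0\<close>.\<close>
declare One_nat_def [simp del]

lemma wf_sweeper: "wf_program sweeper"
  by (auto simp: wf_program_def sweeper_def)

lemma halted_sweeper: "halted sweeper c \<longleftrightarrow> 4 \<le> state c"
  by (simp add: halted_def sweeper_def)

lemma scanned_sweeper:
  "scanned sweeper c = [tape c 0 (head c 0), tape c 1 (head c 1), tape c 2 (head c 2), tape c 3 (head c 3)]"
  by (simp add: scanned_def sweeper_def upt_rec numeral_eq_Suc One_nat_def)

lemma sweeper_state:
  "state (next_config sweeper c) =
    (if 4 \<le> state c then state c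
     else if tape c 1 (head c 1) then (if state c < 2 then 2 else 4)
     else if state c = 0 then 1
     else if state c = 1 then 0
     else if tape c 3 (head c 3) then 3 else 2)"
  by (simp add: next_config_def halted_sweeper scanned_sweeper) (simp add: sweeper_def)

lemma sweeper_heads:
  assumes "state c < 4"
  shows "head (next_config sweeper c) 0 =
      (if state c < 2 \<and> \<not> tape c 1 (head c 1) then ord_suc (head c 0) else head c 0)"
    and "head (next_config sweeper c) 1 =
      (if \<not> tape c 1 (head c 1) then ord_suc (head c 1)
       else if state c < 2 then move_head Left (head c 1) else head c 1)"
    and "head (next_config sweeper c) 2 = head c 2"
    and "head (next_config sweeper c) 3 =
      (if tape c 1 (head c 1) then (if state c < 2 then move_head Left (head c 3) else head c 3)
       else if state c = 0 then head c 3
       else if state c = 1 \<and> \<not> tape c 0 (head c 0) then move_head Left (head c 3)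
       else ord_suc (head c 3))"
  using assms
  by (simp_all add: next_config_def halted_sweeper scanned_sweeper) (simp_all add: sweeper_def)

lemma sweeper_tapes:
  shows "tape (next_config sweeper c) 0 = tape c 0"
    and "tape (next_config sweeper c) 1 = tape c 1"
    and "state c < 4 \<Longrightarrow> tape (next_config sweeper c) 2 =
      (if 2 \<le> state c \<and> tape c 1 (head c 1) then (tape c 2)(head c 2 := (state c = 2)) else tape c 2)"
    and "state c < 4 \<Longrightarrow> tape (next_config sweeper c) 3 =
      (if state c = 0 \<and> \<not> tape c 1 (head c 1) then (tape c 3)(head c 3 := tape c 0 (head c 0)) else tape c 3)"
  by (simp_all add: next_config_def halted_sweeper scanned_sweeper) (auto simp: sweeper_def fun_upd_idem_iff)

lemma sweeper_input_unchanged: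
  fixes w :: "'o::ordinals word"
  assumes "i < 2"
  shows "tape (config_at sweeper w t) i = tape (initial_config w) i"
proof (induction t rule: less_induct)
  case (less t)
  show ?case
  proof (cases t rule: ord_cases)
    case zero
    then show ?thesis by (simp add: config_at_zero)
  next
    case (suc s)
    then have "tape (config_at sweeper w s) i = tape (initial_config w) i"
      by (intro less) (simp add: less_ord_suc)
    with assms show ?thesis
      by (auto simp: suc config_at_suc less_2_cases_iff sweeper_tapes One_nat_def[symmetric])
  next
    case limit
    then have "ord_zero < t" by (simp add: order.not_eq_order_implies_strict)
    then have "liminf_at t (\<lambda>_. True) (\<lambda>r. tape (config_at sweeper w r) i x) = tape (initial_config w) i x" for x
      by (rule liminf_at_bool_eventually_const) (simp add: less)
    then show ?thesis by (simp add: config_at_limit[OF limit] limit_config_def Let_def fun_eq_iff)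
  qed
qed

lemma sweeper_marker:
  "tape (config_at sweeper w t) 1 x \<longleftrightarrow> x = word_length w" for w :: "'o::ordinals word"
  by (simp add: sweeper_input_unchanged initial_config_def)

text \<open>
  In either phase (\<open>q = 0\<close> or \<open>q = 2\<close>) the marker head moves one cell to the right in every step, so after
  \<open>s\<close> steps it is at cell \<open>s\<close> or further; limit steps respect this bound, and also the upper bound
  \<open>a\<close>, because the head is an inferior limit of such positions. Hence it meets the end mark
  after at most \<open>a\<close> steps.
\<close>

lemma sweeper_reaches_end:
  fixes w :: "'o::ordinals word"
  defines "C \<equiv> config_at sweeper w" and "a \<equiv> word_length w"
  assumes q: "q = 0 \<or> q = 2"
    and start: "state (C t) \<in> {q, Suc q}" "head (C t) 1 \<le> a"
  shows "\<exists>s\<le>a. state (C (ord_add t s)) \<in> {q, Suc q} \<and> head (C (ord_add t s)) 1 = a"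
proof (rule ccontr)
  assume neg: "\<not> ?thesis"
  have "state (C (ord_add t s)) \<in> {q, Suc q} \<and> s \<le> head (C (ord_add t s)) 1 \<and> head (C (ord_add t s)) 1 \<le> a"
    if "s \<le> a" for s
    using that
  proof (induction s rule: less_induct)
    case (less s)
    show ?case
    proof (cases s rule: ord_cases)
      case zero
      with start show ?thesis by simp
    next
      case (suc r)
      have "r < s" by (simp add: suc less_ord_suc)
      with less.prems have ra: "r \<le> a" by simp
      let ?c = "C (ord_add t r)"
      have IH: "state ?c \<in> {q, Suc q}" "r \<le> head ?c 1" "head ?c 1 \<le> a"
        using less.IH[OF \<open>r < s\<close> ra] by auto
      have "head ?c 1 \<noteq> a" using neg IH(1) ra by blast
      with IH(3) have "head ?c 1 < a" by simp
      moreover have "\<not> tape ?c 1 (head ?c 1)"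
        using \<open>head ?c 1 \<noteq> a\<close> by (simp add: C_def a_def sweeper_marker)
      moreover have "C (ord_add t s) = next_config sweeper ?c" by (simp add: suc C_def config_at_suc)
      moreover have "ord_suc r \<le> ord_suc (head ?c 1)"
        using IH(2) by (simp add: ord_suc_le_iff)
      ultimately show ?thesis
        using q IH(1) by (auto simp: sweeper_state sweeper_heads ord_suc_le_iff suc)
    next
      case limit
      let ?t = "ord_add t s"
      have "ord_zero < s" using limit by (simp add: order.not_eq_order_implies_strict)
      then have tt: "t < ?t" using ord_add_strict_mono[of ord_zero s t] by simp
      then have "?t \<noteq> ord_zero" using leD[OF ord_zero_le] by metis
      note config = config_at_limit[OF this ord_add_limit(1)[OF limit], of sweeper w, folded C_def]
      \<comment> \<open>The limit looks at all earlier times, but times before \<open>t\<close> are irrelevant to it.\<close>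
      have past: "state (C r) \<in> {q, Suc q} \<and> (\<exists>c<s. r = ord_add t c \<and> c \<le> head (C r) 1 \<and> head (C r) 1 \<le> a)"
        if r: "t \<le> r" "r < ?t" for r
      proof -
        obtain c where "c < s" "r = ord_add t c" using ord_add_split[OF r] by blast
        with less.IH[of c] less.prems show ?thesis by auto
      qed
      have bound: "state (C r) \<le> Suc q" if "t \<le> r" "r < ?t" for r
        using past[OF that] by auto
      have st: "\<exists>r. u \<le> r \<and> r < ?t \<and> state (C r) = state (C ?t)" if "u < ?t" for u
        using liminf_at_nat[OF tt bound that] unfolding config limit_config_def Let_def by simp
      have st_in: "state (C ?t) \<in> {q, Suc q}"
        using st[OF tt] past by metis
      have hd: "head (C ?t) 1 = liminf_at ?t (\<lambda>r. state (C r) = state (C ?t)) (\<lambda>r. head (C r) 1)"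
        unfolding config limit_config_def Let_def by simp
      have often: "\<exists>r. u \<le> r \<and> r < ?t \<and> state (C r) = state (C ?t) \<and> head (C r) 1 \<le> a" if u: "u < ?t" for u
      proof -
        obtain r where r: "max t u \<le> r" "r < ?t" "state (C r) = state (C ?t)" using st[of "max t u"] tt u by auto
        with past[of r] show ?thesis by (intro exI[of _ r]) auto
      qed
      have "head (C ?t) 1 \<le> a" unfolding hd using often by (rule liminf_at_le)
      moreover have "s \<le> head (C ?t) 1"
      proof (rule ccontr)
        assume "\<not> s \<le> head (C ?t) 1"
        \<comment> \<open>At times from \<open>t\<close> plus this successor on, the head was beyond its alleged limit position.\<close>
        then have "ord_suc (head (C ?t) 1) < s" using limit(2) by (intro limit_suc_less) simp_all
        then have "ord_add t (ord_suc (head (C ?t) 1)) < ?t" by (rule ord_add_strict_mono)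
        then obtain r where r: "ord_add t (ord_suc (head (C ?t) 1)) \<le> r" "r < ?t"
            "head (C r) 1 \<le> head (C ?t) 1"
          using liminf_at_often_le_limit[OF often] unfolding hd[symmetric] by metis
        have "t \<le> r" using le_ord_add r(1) by (rule order_trans)
        then obtain c where c: "r = ord_add t c" "c \<le> head (C r) 1" using past[OF _ r(2)] by blast
        then have "c < ord_suc (head (C ?t) 1)" using r(3) less_ord_suc by (meson le_less_trans)
        then have "r < ord_add t (ord_suc (head (C ?t) 1))" unfolding c(1) by (rule ord_add_strict_mono)
        with r(1) show False by (meson leD)
      qed
      ultimately show ?thesis using st_in by simp
    qed
  qed
  from this[of a] neg show False by auto
qed

lemma sweeper_halts:
  fixes w :: "'o::ordinals word"
  defines "a \<equiv> word_length w"
  shows "\<exists>t. halts_at sweeper w t \<and> t \<le> ord_suc (ord_add (ord_suc a) a)"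
proof -
  let ?C = "config_at sweeper w"
  have "state (?C ord_zero) = 0" "head (?C ord_zero) 1 = ord_zero"
    by (simp_all add: config_at_zero initial_config_def)
  then obtain s where s: "s \<le> a" "state (?C s) \<in> {0, 1}" "head (?C s) 1 = a"
    using sweeper_reaches_end[of 0 w ord_zero] unfolding a_def by auto
  then have "tape (?C s) 1 (head (?C s) 1)" by (simp add: sweeper_marker a_def)
  with s have "state (?C (ord_suc s)) = 2" "head (?C (ord_suc s)) 1 \<le> a"
    using move_head_le[of a] by (auto simp: config_at_suc sweeper_state sweeper_heads)
  then obtain r where r: "r \<le> a" "state (?C (ord_add (ord_suc s) r)) \<in> {2, 3}"
      "head (?C (ord_add (ord_suc s) r)) 1 = a"
    using sweeper_reaches_end[of 2 w "ord_suc s"] unfolding a_def by auto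
  let ?t = "ord_suc (ord_add (ord_suc s) r)"
  have "halted sweeper (?C ?t)"
    using r(2,3) by (auto simp: halted_sweeper config_at_suc sweeper_state sweeper_marker a_def)
  then obtain t where t: "halts_at sweeper w t" "t \<le> ?t" using halts_at_least by blast
  have "ord_suc s \<le> ord_suc a" using s(1) by (simp add: ord_suc_le_iff)
  then have "ord_add (ord_suc s) r \<le> ord_add (ord_suc a) a"
    using r(1) by (meson ord_add_mono_left ord_add_mono_right order_trans)
  then have "?t \<le> ord_suc (ord_add (ord_suc a) a)"
    by (simp add: ord_suc_le_iff)
  with t show ?thesis by (meson order_trans)
qed

text \<open>
  The language is defined as what the machine accepts, so that only its running time has to be
  controlled on words of all lengths. Its content matters for words of length \<open>\<omega>\<close> only.
\<close>

definition swept_words :: "'o::ordinals word set" where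
  "swept_words = {w \<in> words. \<exists>t. halts_at sweeper w t \<and> tape (config_at sweeper w t) 2 ord_zero}"

lemma sweeper_decides: "decides sweeper (swept_words :: 'o::ordinals word set)"
  unfolding decides_def
proof (intro conjI ballI)
  fix w :: "'o word" assume "w \<in> words"
  moreover obtain t where "halts_at sweeper w t" using sweeper_halts by blast
  ultimately show "\<exists>t. halts_at sweeper w t \<and> (tape (config_at sweeper w t) 2 ord_zero \<longleftrightarrow> w \<in> swept_words)"
    unfolding swept_words_def using halts_at_unique by blast
qed (rule wf_sweeper)

lemma word_length_eq: "dom w = {..<a} \<Longrightarrow> word_length w = a" for w :: "'o::ordinals word"
  unfolding word_length_def by (rule the_equality) (auto dest: lessThan_eq_iff[THEN iffD1])

lemma swept_words_in_time: "decidable_in_time_times (swept_words :: 'o::ordinals word set) 4"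
  unfolding decidable_in_time_times_def
proof (intro exI[of _ sweeper] conjI sweeper_decides ballI impI)
  fix w :: "'o word" assume w: "w \<in> words" "w \<noteq> Map.empty"
  define a where "a = word_length w"
  obtain b where b: "dom w = {..<b}" using w(1) unfolding words_def by blast
  then have "dom w = {..<a}" unfolding a_def by (simp add: word_length_eq)
  with w(2) have "a \<noteq> ord_zero" using leD[OF ord_zero_le] by (auto simp: dom_eq_empty_conv[symmetric] simp del: dom_eq_empty_conv)
  \<comment> \<open>Each of the two extra steps is paid for by one more copy of the length, which is at least \<open>1\<close>.\<close>
  then have "ord_suc ord_zero \<le> a" by (simp add: ord_suc_le_iff order.not_eq_order_implies_strict)
  then have plus: "ord_suc x \<le> ord_add x a" for x
    using ord_add_mono_right[of "ord_suc ord_zero" a x] by simp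
  have "ord_add (ord_suc a) a \<le> ord_add (ord_add a a) a" using plus by (rule ord_add_mono_left)
  then have "ord_add (ord_add (ord_suc a) a) a \<le> ord_add (ord_add (ord_add a a) a) a"
    by (rule ord_add_mono_left)
  with plus[of "ord_add (ord_suc a) a"] ord_mult_four_ge[of a]
  have "ord_suc (ord_add (ord_suc a) a) \<le> ord_mult a (ord_of_nat 4)" by (meson order_trans)
  with sweeper_halts[of w] show "\<exists>t. halts_at sweeper w t \<and> t \<le> ord_mult (word_length w) (ord_of_nat 4)"
    unfolding a_def by (meson order_trans)
qed

section \<open>The sweeping machine on words of length \<open>\<omega>\<close>\<close>

definition omega_word :: "(nat \<Rightarrow> bool) \<Rightarrow> 'o::ordinals word" where
  "omega_word x u = (if u < omega then Some (x (THE n. u = fin n)) else None)"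

lemma omega_word_fin [simp]: "omega_word x (fin n) = Some (x n)"
  by (simp add: omega_word_def)

lemma dom_omega_word: "dom (omega_word x) = {..<omega}"
  by (auto simp: omega_word_def split: if_splits)

lemma omega_word_in_words [simp]: "omega_word x \<in> words"
  unfolding words_def using dom_omega_word by blast

lemma word_length_omega_word [simp]: "word_length (omega_word x) = omega"
  by (rule word_length_eq) (rule dom_omega_word)

lemma initial_omega_word:
  "tape (initial_config (omega_word x)) 0 (fin n) = x n"
  "omega \<le> u \<Longrightarrow> tape (initial_config (omega_word x)) i u = (i = 1 \<and> u = omega)"
  by (auto simp: initial_config_def omega_word_def)

text \<open>
  \<open>track x t\<close> and \<open>written x t\<close> are the position of the scratch head and the content of the scratch tape
  after \<open>t\<close> commands, that is after \<open>2 * t\<close> steps, on input \<open>x\<close>.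
\<close>

primrec track :: "(nat \<Rightarrow> bool) \<Rightarrow> nat \<Rightarrow> nat" where
  "track x 0 = 0"
| "track x (Suc t) = (if x (Suc (2 * t)) then Suc (track x t) else track x t - 1)"

primrec written :: "(nat \<Rightarrow> bool) \<Rightarrow> nat \<Rightarrow> nat \<Rightarrow> bool" where
  "written x 0 = (\<lambda>_. False)"
| "written x (Suc t) = (written x t)(track x t := x (2 * t))"

lemma move_head_Left_fin: "move_head Left (fin n) = (fin (n - 1) :: 'o::ordinals)"
proof (cases n)
  case 0
  have "\<not> is_suc (ord_zero :: 'o)" using ord_suc_not_zero unfolding is_suc_def by metis
  with 0 show ?thesis by simp
qed simp

lemma fin_neq_omega [simp]: "fin n \<noteq> (omega :: 'o::ordinals)" "omega \<noteq> (fin n :: 'o::ordinals)"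
  by (metis ord_plus_less_next_limit order.irrefl)+

lemma sweeper_writes:
  fixes x :: "nat \<Rightarrow> bool"
  defines "C \<equiv> \<lambda>n. config_at sweeper (omega_word x :: 'o::ordinals word) (fin n)"
  shows "state (C (2 * t)) = 0 \<and> head (C (2 * t)) 0 = fin (2 * t) \<and> head (C (2 * t)) 1 = fin (2 * t) \<and>
     head (C (2 * t)) 2 = ord_zero \<and> head (C (2 * t)) 3 = fin (track x t) \<and>
     (\<forall>j. tape (C (2 * t)) 3 (fin j) = written x t j)"
    (is "?even t")
  and "state (C (Suc (2 * t))) = 1 \<and> head (C (Suc (2 * t))) 0 = fin (Suc (2 * t)) \<and>
     head (C (Suc (2 * t))) 1 = fin (Suc (2 * t)) \<and>
     head (C (Suc (2 * t))) 2 = ord_zero \<and> head (C (Suc (2 * t))) 3 = fin (track x t) \<and>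
     (\<forall>j. tape (C (Suc (2 * t))) 3 (fin j) = written x (Suc t) j)"
    (is "?odd t")
proof -
  have next_C: "C (Suc n) = next_config sweeper (C n)" for n by (simp add: C_def config_at_suc)
  have input: "tape (C n) 0 (fin m) = x m" for n m
    by (simp add: C_def sweeper_input_unchanged initial_omega_word)
  have marker: "\<not> tape (C n) 1 (fin m)" for n m
    by (simp add: C_def sweeper_marker)
  have input_suc: "tape (C n) 0 (ord_suc (fin m)) = x (Suc m)" for n m
    using input[of n "Suc m"] by simp
  have marker_suc: "\<not> tape (C n) 1 (ord_suc (fin m))" for n m
    using marker[of n "Suc m"] by simp
  have odd: "?odd t" if "?even t" for t
    using that
    by (simp add: next_C sweeper_state sweeper_heads sweeper_tapes input marker)
  have even: "?even t" for t
  proof (induction t)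
    case 0
    show ?case by (simp add: C_def config_at_zero initial_config_def)
  next
    case (Suc t)
    have two: "2 * Suc t = Suc (Suc (2 * t))" by simp
    from odd[OF Suc] show ?case
      unfolding two next_C[of "Suc (2 * t)"]
      by (simp add: sweeper_state sweeper_heads sweeper_tapes input_suc marker_suc move_head_Left_fin del: written.simps move_head.simps(1))
  qed
  from even odd show "?even t" "?odd t" by blast+
qed

lemma MOST_div_2: "(MOST n. P (n div 2)) \<longleftrightarrow> (MOST n. P (n::nat))"
proof
  assume "MOST n. P (n div 2)"
  then obtain m where m: "\<And>n. m \<le> n \<Longrightarrow> P (n div 2)" unfolding MOST_nat_le by blast
  then have "P n" if "m \<le> n" for n using m[of "2 * n"] that by simp
  then show "MOST n. P n" unfolding MOST_nat_le by blast
next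
  assume "MOST n. P n"
  then obtain m where m: "\<And>n. m \<le> n \<Longrightarrow> P n" unfolding MOST_nat_le by blast
  have "P (n div 2)" if "2 * m \<le> n" for n using m[of "n div 2"] that by simp
  then show "MOST n. P (n div 2)" unfolding MOST_nat_le by blast
qed

text \<open>
  The states \<open>0\<close> and \<open>1\<close> alternate, so the limit state is \<open>0\<close> for every input, and the input heads
  converge to cell \<open>\<omega>\<close>, where the end mark is. About the limit position of the scratch head nothing
  is known, but after the step to the left it is finite.
\<close>

lemma sweeper_after_writing:
  fixes x :: "nat \<Rightarrow> bool"
  defines "c \<equiv> config_at sweeper (omega_word x :: 'o::ordinals word) (ord_suc omega)"
  obtains h where "state c = 2" "head c 1 = ord_zero" "head c 2 = ord_zero" "head c 3 = fin h"
    "\<And>j. tape c 3 (fin j) \<longleftrightarrow> (MOST t. written x t j)"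
proof -
  let ?C = "\<lambda>t. config_at sweeper (omega_word x :: 'o word) t"
  let ?d = "?C omega"
  have even: "state (?C (fin (2 * t))) = 0" for t using sweeper_writes(1)[of x t] by blast
  have cases_n: "\<exists>t. n = 2 * t \<or> n = Suc (2 * t)" for n by presburger
  have h1: "head (?C (fin n)) 1 = fin n" for n
    using sweeper_writes[of x] cases_n[of n] by metis
  have h2: "head (?C (fin n)) 2 = ord_zero" for n
    using sweeper_writes[of x] cases_n[of n] by metis
  have h3: "\<exists>m. head (?C (fin n)) 3 = fin m" for n
    using sweeper_writes[of x] cases_n[of n] by metis
  have t3: "tape (?C (fin n)) 3 (fin j) = written x (Suc n div 2) j" for n j
  proof -
    have "tape (?C (fin (2 * t))) 3 (fin j) = written x t j"
      "tape (?C (fin (Suc (2 * t)))) 3 (fin j) = written x (Suc t) j" for t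
      using sweeper_writes[where x = x and t = t and ?'o = 'o] by blast+
    moreover have "Suc (2 * t) div 2 = t" "Suc (Suc (2 * t)) div 2 = Suc t" for t by simp_all
    ultimately show ?thesis using cases_n[of n] by metis
  qed
  have lim: "?d = limit_config omega ?C" by (rule config_at_limit) simp_all
  have "INFM n. state (?C (fin n)) = 0"
    unfolding INFM_nat_le using even by (metis le_add1 mult_2)
  moreover have st: "state ?d = 0"
    unfolding lim limit_config_def Let_def
    by (simp, rule liminf_next_limit_eqI) (use calculation in simp_all)
  ultimately have often: "INFM n. state (?C (fin n)) = state ?d" by simp
  have hd: "head ?d i = liminf_at omega (\<lambda>r. state (?C r) = state ?d) (\<lambda>r. head (?C r) i)" for i
    unfolding lim limit_config_def Let_def by simp
  have hd1: "head ?d 1 = omega" unfolding hd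
  proof (rule liminf_next_limit_eqI)
    show "INFM n. state (?C (fin n)) = state ?d \<and> head (?C (fin n)) 1 \<le> omega"
      using often by (rule INFM_mono) (simp add: h1 less_imp_le)
    show "MOST n. state (?C (fin n)) = state ?d \<longrightarrow> v < head (?C (fin n)) 1" if v: "v < omega" for v
    proof -
      obtain m where "v = fin m" using v unfolding less_omega_iff by blast
      then show ?thesis unfolding MOST_nat h1 by (intro exI[of _ m]) simp
    qed
  qed
  have hd2: "head ?d 2 = ord_zero" unfolding hd
    by (rule liminf_next_limit_eqI) (use often in \<open>simp_all add: h2 leD[OF ord_zero_le]\<close>)
  have "head ?d 3 \<le> omega" unfolding hd
  proof (rule liminf_at_le)
    fix s :: 'o assume "s < omega"
    then obtain r where r: "s \<le> r" "r < omega" "state (?C r) = state ?d"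
      using often INFM_next_limit[of ord_zero "\<lambda>r. state (?C r) = state ?d"] by blast
    then obtain n where "r = fin n" unfolding less_omega_iff by blast
    with h3[of n] have "head (?C r) 3 \<le> omega" by (auto intro: less_imp_le)
    with r show "\<exists>r. s \<le> r \<and> r < omega \<and> state (?C r) = state ?d \<and> head (?C r) 3 \<le> omega" by blast
  qed
  then have "\<exists>h. move_head Left (head ?d 3) = fin h"
  proof (cases "head ?d 3 = omega")
    case True
    then show ?thesis by (intro exI[of _ 0]) simp
  next
    case False
    with \<open>head ?d 3 \<le> omega\<close> have "head ?d 3 < omega" by simp
    then obtain m where "head ?d 3 = fin m" unfolding less_omega_iff by blast
    then show ?thesis using move_head_Left_fin by metis
  qed
  then obtain h where h: "move_head Left (head ?d 3) = fin h" by blast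
  have tp: "tape ?d 3 (fin j) \<longleftrightarrow> (MOST t. written x t j)" for j
  proof -
    have "tape ?d 3 (fin j) \<longleftrightarrow> (MOST n. written x (Suc n div 2) j)"
      unfolding lim limit_config_def Let_def by (simp add: liminf_next_limit_bool t3)
    also have "\<dots> \<longleftrightarrow> (MOST n. written x (n div 2) j)"
      using MOST_Suc_iff[of "\<lambda>n. written x (n div 2) j"] by simp
    also have "\<dots> \<longleftrightarrow> (MOST t. written x t j)" using MOST_div_2[of "\<lambda>t. written x t j"] .
    finally show ?thesis .
  qed
  have c: "c = next_config sweeper ?d" by (simp add: c_def config_at_suc)
  have marked: "tape ?d 1 (head ?d 1)" by (simp add: sweeper_marker hd1)
  show ?thesis
  proof (rule that[of h])
    show "state c = 2" using marked by (simp add: c sweeper_state st)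
    show "head c 1 = ord_zero" using marked by (simp add: c sweeper_heads st hd1)
    show "head c 2 = ord_zero" by (simp add: c sweeper_heads st hd2)
    show "head c 3 = fin h" using marked h by (simp add: c sweeper_heads st)
    show "tape c 3 (fin j) \<longleftrightarrow> (MOST t. written x t j)" for j
      using marked tp by (simp add: c sweeper_tapes st)
  qed
qed

lemma INFM_Suc_iff: "(INFM n. P (Suc n)) \<longleftrightarrow> (INFM n. P n)"
  using MOST_Suc_iff[of "\<lambda>n. \<not> P n"] by (simp add: not_INFM[symmetric] del: not_INFM)

lemma INFM_shift: "(INFM n. P (k + n)) \<longleftrightarrow> (INFM n. P (n::nat))"
proof (induction k)
  case (Suc k)
  then show ?case using INFM_Suc_iff[of "\<lambda>n. P (k + n)"] by simp
qed simp

text \<open>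
  The scratch tape at time \<open>\<omega>\<close> has a \<open>0\<close> exactly in the cells that are not eventually \<open>1\<close>, and the sweep
  decides whether there are infinitely many of them. Thus membership has the form
  ``infinitely often for infinitely many \<open>j\<close>'', one level above what a single limit can decide.
\<close>

lemma swept_omega_word_iff:
  "(omega_word x :: 'o::ordinals word) \<in> swept_words \<longleftrightarrow> (INFM j. \<not> (MOST t. written x t j))"
proof -
  let ?w = "omega_word x :: 'o word"
  let ?L = "\<lambda>j. MOST t. written x t j"
  let ?t = "ord_suc omega :: 'o"
  define C where "C n = config_at sweeper ?w (?t \<oplus> n)" for n
  have "C 0 = config_at sweeper ?w (ord_suc omega)" by (simp add: C_def)
  then obtain h where start: "state (C 0) = 2" "head (C 0) 1 = ord_zero" "head (C 0) 2 = ord_zero"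
      "head (C 0) 3 = fin h" "\<And>j. tape (C 0) 3 (fin j) \<longleftrightarrow> ?L j"
    using sweeper_after_writing[where x = x and ?'o = 'o] by metis
  have next_C: "C (Suc n) = next_config sweeper (C n)" for n by (simp add: C_def config_at_suc)
  have marker: "\<not> tape (C n) 1 (fin m)" for n m by (simp add: C_def sweeper_marker)
  have run: "state (C n) \<in> {2, 3} \<and> head (C n) 1 = fin n \<and> head (C n) 2 = ord_zero \<and>
      head (C n) 3 = fin (h + n) \<and> (\<forall>j. tape (C n) 3 (fin j) \<longleftrightarrow> ?L j)" for n
  proof (induction n)
    case 0
    show ?case using start by simp
  next
    case (Suc n)
    then show ?case by (auto simp: next_C sweeper_state sweeper_heads sweeper_tapes marker)
  qed
  have state_Suc: "state (C (Suc n)) = 2 \<longleftrightarrow> \<not> ?L (h + n)" for n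
  proof -
    have "\<not> tape (C n) 1 (head (C n) 1)" "tape (C n) 3 (head (C n) 3) \<longleftrightarrow> ?L (h + n)"
      using run[of n] marker by metis+
    moreover have "state (C n) = 2 \<or> state (C n) = 3" using run[of n] by blast
    ultimately show ?thesis by (auto simp only: next_C sweeper_state) simp_all
  qed
  let ?l = "next_limit ?t"
  let ?C = "config_at sweeper ?w"
  let ?d = "?C ?l"
  have lim: "?d = limit_config ?l ?C" by (rule config_at_limit) simp_all
  have inf: "(INFM n. state (C n) = 2) \<longleftrightarrow> (INFM j. \<not> ?L j)"
    using INFM_Suc_iff[of "\<lambda>n. state (C n) = 2"] INFM_shift[of "\<lambda>j. \<not> ?L j" h]
    by (simp only: state_Suc)
  have st: "state ?d = (if INFM j. \<not> ?L j then 2 else 3)"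
  proof (cases "INFM j. \<not> ?L j")
    case True
    with inf have "INFM n. state (C n) = 2" by blast
    then have "INFM n. state (C n) \<le> 2" by (rule INFM_mono) simp
    moreover have "v < state (C n)" if "v < 2" for v n using run[of n] that by auto
    ultimately have "liminf_at ?l (\<lambda>_. True) (\<lambda>r. state (?C r)) = 2"
      by (intro liminf_next_limit_eqI) (simp_all add: C_def)
    with True show ?thesis unfolding lim limit_config_def Let_def by simp
  next
    case False
    then have most: "MOST n. state (C n) \<noteq> 2"
      using inf not_INFM[of "\<lambda>n. state (C n) = 2"] by blast
    have "state (C n) \<noteq> 2 \<Longrightarrow> state (C n) = 3" for n using run[of n] by auto
    with most have most3: "MOST n. state (C n) = 3" by (rule MOST_mono)
    have "liminf_at ?l (\<lambda>_. True) (\<lambda>r. state (?C r)) = 3"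
    proof (rule liminf_next_limit_eqI)
      show "INFM n. True \<and> state (?C (?t \<oplus> n)) \<le> 3"
        using MOST_INFM[OF infinite_UNIV_nat most3] by (rule INFM_mono) (simp add: C_def)
      show "MOST n. True \<longrightarrow> v < state (?C (?t \<oplus> n))" if "v < 3" for v
        using most3 by (rule MOST_mono) (use that in \<open>simp add: C_def\<close>)
    qed
    with False show ?thesis unfolding lim limit_config_def Let_def by simp
  qed
  have hd: "head ?d i = liminf_at ?l (\<lambda>r. state (?C r) = state ?d) (\<lambda>r. head (?C r) i)" for i
    unfolding lim limit_config_def Let_def by simp
  have often: "INFM n. state (C n) = state ?d"
  proof (cases "INFM j. \<not> ?L j")
    case True
    with inf st show ?thesis by simp
  next
    case False
    then have most: "MOST n. state (C n) \<noteq> 2"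
      using inf not_INFM[of "\<lambda>n. state (C n) = 2"] by blast
    have "state (C n) \<noteq> 2 \<Longrightarrow> state (C n) = 3" for n using run[of n] by auto
    with most have "MOST n. state (C n) = 3" by (rule MOST_mono)
    then have "INFM n. state (C n) = 3" by (rule MOST_INFM[OF infinite_UNIV_nat])
    moreover have "state ?d = 3" using False by (simp only: st if_False)
    ultimately show ?thesis by (simp only:)
  qed
  have hd1: "head ?d 1 = omega" unfolding hd
  proof (rule liminf_next_limit_eqI)
    show "INFM n. state (?C (?t \<oplus> n)) = state ?d \<and> head (?C (?t \<oplus> n)) 1 \<le> omega"
      using often by (rule INFM_mono) (use run in \<open>simp add: C_def less_imp_le\<close>)
    show "MOST n. state (?C (?t \<oplus> n)) = state ?d \<longrightarrow> v < head (?C (?t \<oplus> n)) 1" if v: "v < omega" for v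
    proof -
      obtain m where "v = fin m" using v unfolding less_omega_iff by blast
      then show ?thesis using run unfolding MOST_nat C_def by (intro exI[of _ m]) simp
    qed
  qed
  have hd2: "head ?d 2 = ord_zero" unfolding hd
    by (rule liminf_next_limit_eqI) (use often run in \<open>simp_all add: C_def leD[OF ord_zero_le]\<close>)
  have marked: "tape ?d 1 (head ?d 1)" by (simp add: sweeper_marker hd1)
  let ?e = "?C (ord_suc ?l)"
  have "halted sweeper ?e" using marked by (simp add: halted_sweeper config_at_suc sweeper_state st)
  then obtain t where t: "t \<le> ord_suc ?l" "halts_at sweeper ?w t" using halts_at_least by blast
  then have "?e = ?C t" unfolding halts_at_def by (intro halted_stays) simp_all
  moreover have "tape ?e 2 ord_zero \<longleftrightarrow> (INFM j. \<not> ?L j)"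
    using marked by (simp add: config_at_suc sweeper_tapes st hd2)
  ultimately have "tape (?C t) 2 ord_zero \<longleftrightarrow> (INFM j. \<not> ?L j)" by (simp only:)
  moreover have "?w \<in> swept_words \<longleftrightarrow> (\<exists>s. halts_at sweeper ?w s \<and> tape (?C s) 2 ord_zero)"
    by (simp add: swept_words_def)
  moreover have "\<dots> \<longleftrightarrow> tape (?C t) 2 ord_zero" using t(2) halts_at_unique by metis
  ultimately show ?thesis by blast
qed

declare One_nat_def [simp]

section \<open>Values taken infinitely often\<close>

definition inf_values :: "(nat \<Rightarrow> nat) \<Rightarrow> nat set" where
  "inf_values f = {v. INFM k. f k = v}"

primrec occurrences :: "(nat \<Rightarrow> nat) \<Rightarrow> nat \<Rightarrow> nat \<Rightarrow> nat" where
  "occurrences f v 0 = 0"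
| "occurrences f v (Suc k) = occurrences f v k + (if f k = v then 1 else 0)"

text \<open>
  For a sequence with finitely many values, ``\<open>V\<close> is the set of values taken infinitely often'' is
  a conjunction of statements ``eventually'' and ``infinitely often''. It is expressed here by a single
  ``infinitely often'', at the price of a parameter \<open>s\<close>: the time at which the sequence enters \<open>V\<close> forever.
  That every element of \<open>V\<close> recurs is witnessed by the times at which the value just taken is a least
  frequent element of \<open>V\<close> so far. For each such sequence exactly one pair of \<open>V\<close> and \<open>s\<close> has infinitely many renewals.
\<close>

definition renewal :: "(nat \<Rightarrow> nat) \<Rightarrow> nat set \<Rightarrow> nat \<Rightarrow> nat \<Rightarrow> bool" where
  "renewal f V s k \<longleftrightarrow>
     s \<le> k \<and> (\<forall>r. s \<le> r \<and> r \<le> k \<longrightarrow> f r \<in> V) \<and> (s = 0 \<or> f (s - 1) \<notin> V) \<and>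
     (\<forall>u\<in>V. occurrences f (f k) (Suc k) \<le> occurrences f u (Suc k))"

lemma inf_values_INFM:
  assumes "finite (range f)"
  shows "(INFM k. \<Phi> (f k)) \<longleftrightarrow> (\<exists>v\<in>inf_values f. \<Phi> v)"
proof
  assume "INFM k. \<Phi> (f k)"
  then have "INFM k. \<exists>v\<in>range f. \<Phi> v \<and> f k = v" by (rule INFM_mono) blast
  then obtain v where "INFM k. \<Phi> v \<and> f k = v" unfolding INFM_finite_Bex_distrib[OF assms] by blast
  moreover from this have "INFM k. f k = v" by (rule INFM_mono) blast
  moreover have "\<Phi> v" using calculation(1) by (auto dest: INFM_EX)
  ultimately show "\<exists>v\<in>inf_values f. \<Phi> v" unfolding inf_values_def by blast
next
  assume "\<exists>v\<in>inf_values f. \<Phi> v"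
  then obtain v where "\<Phi> v" "INFM k. f k = v" unfolding inf_values_def by blast
  from this(2) show "INFM k. \<Phi> (f k)" by (rule INFM_mono) (simp add: \<open>\<Phi> v\<close>)
qed

lemma occurrences_le: "occurrences f v k \<le> k"
  by (induction k) auto

lemma occurrences_mono: "k \<le> l \<Longrightarrow> occurrences f v k \<le> occurrences f v l"
  by (induction l) (auto simp: le_Suc_eq)

lemma occurrences_bounded:
  assumes "\<And>k. m \<le> k \<Longrightarrow> f k \<noteq> v"
  shows "occurrences f v k \<le> m"
proof (induction k)
  case (Suc k)
  show ?case
  proof (cases "m \<le> k")
    case True
    with Suc assms show ?thesis by simp
  next
    case False
    with occurrences_le[of f v "Suc k"] show ?thesis by linarith
  qed
qed simp

lemma occurrences_unbounded:
  assumes "INFM k. f k = v"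
  shows "MOST k. m \<le> occurrences f v k"
proof (induction m)
  case (Suc m)
  then obtain K where K: "\<And>k. K \<le> k \<Longrightarrow> m \<le> occurrences f v k" unfolding MOST_nat_le by blast
  obtain k where k: "K \<le> k" "f k = v" using assms unfolding INFM_nat_le by blast
  then have "Suc m \<le> occurrences f v (Suc k)" using K[of k] by simp
  then have "\<forall>l\<ge>Suc k. Suc m \<le> occurrences f v l" using occurrences_mono order_trans by blast
  then show ?case unfolding MOST_nat_le by blast
qed simp

lemma renewal_inside:
  assumes "INFM k. renewal f V s k" "s \<le> r"
  shows "f r \<in> V"
proof -
  obtain k where "r \<le> k" "renewal f V s k" using assms(1) unfolding INFM_nat_le by blast
  with assms(2) show ?thesis unfolding renewal_def by blast
qed

text \<open>
  If \<open>v\<close> is the value at infinitely many renewals, its number of occurrences tends to infinity and bounds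
  the number of occurrences of each element of \<open>V\<close> from below at these times.
\<close>

lemma renewal_inf_values:
  assumes "finite V" and often: "INFM k. renewal f V s k"
  shows "V = inf_values f"
proof
  show "inf_values f \<subseteq> V"
  proof
    fix v assume "v \<in> inf_values f"
    then obtain r where "s \<le> r" "f r = v" unfolding inf_values_def INFM_nat_le by blast
    with renewal_inside[OF often] show "v \<in> V" by blast
  qed
  have "INFM k. \<exists>v\<in>V. renewal f V s k \<and> f k = v"
    using often by (rule INFM_mono) (simp add: renewal_def)
  then obtain v where v: "INFM k. renewal f V s k \<and> f k = v"
    unfolding INFM_finite_Bex_distrib[OF assms(1)] by blast
  then have inf: "INFM k. f k = v" by (rule INFM_mono) simp
  show "V \<subseteq> inf_values f"
  proof
    fix u assume "u \<in> V"
    show "u \<in> inf_values f"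
    proof (rule ccontr)
      assume "u \<notin> inf_values f"
      then have "MOST k. f k \<noteq> u" using not_INFM[of "\<lambda>k. f k = u"] unfolding inf_values_def by blast
      then obtain m where m: "\<And>k. m \<le> k \<Longrightarrow> f k \<noteq> u" unfolding MOST_nat_le by blast
      obtain K where K: "\<And>k. K \<le> k \<Longrightarrow> Suc m \<le> occurrences f v k"
        using occurrences_unbounded[OF inf, of "Suc m"] unfolding MOST_nat_le by blast
      obtain k where k: "K \<le> k" "renewal f V s k" "f k = v" using v unfolding INFM_nat_le by blast
      have "Suc m \<le> occurrences f v (Suc k)" using K[of "Suc k"] k(1) by simp
      also have "\<dots> \<le> occurrences f u (Suc k)"
        using k(2,3) \<open>u \<in> V\<close> unfolding renewal_def by blast
      also have "\<dots> \<le> m" using m by (rule occurrences_bounded)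
      finally show False by simp
    qed
  qed
qed

lemma renewal_unique:
  assumes "INFM k. renewal f V s k" "INFM k. renewal f V s' k"
  shows "s = s'"
proof -
  have "\<not> s < s'" if s: "INFM k. renewal f V s k" and s': "INFM k. renewal f V s' k" for s s'
  proof
    assume "s < s'"
    moreover obtain k where "renewal f V s' k" using s' by (blast dest: INFM_EX)
    ultimately have "f (s' - 1) \<notin> V" unfolding renewal_def by auto
    with renewal_inside[OF s, of "s' - 1"] \<open>s < s'\<close> show False by simp
  qed
  with assms show ?thesis by (meson linorder_neqE_nat)
qed

text \<open>
  The first time at which all elements of \<open>V\<close> have occurred \<open>L\<close> times is a renewal: the value that occurs
  then has occurred exactly \<open>L\<close> times. A large \<open>L\<close> makes this time late.
\<close>

lemma renewal_exists:
  assumes fin: "finite (range f)"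
  shows "\<exists>s. INFM k. renewal f (inf_values f) s k"
proof -
  define V where "V = inf_values f"
  have "V \<subseteq> range f" unfolding V_def inf_values_def by (auto dest: INFM_EX)
  then have finV: "finite V" using fin by (rule finite_subset)
  have "\<not> (INFM k. f k \<notin> V)" using inf_values_INFM[OF fin, of "\<lambda>v. v \<notin> V"] unfolding V_def by blast
  then have "\<exists>s. \<forall>r\<ge>s. f r \<in> V" using not_INFM[of "\<lambda>k. f k \<notin> V"] unfolding MOST_nat_le by blast
  then obtain s where s: "\<forall>r\<ge>s. f r \<in> V" and least: "\<And>s'. s' < s \<Longrightarrow> \<not> (\<forall>r\<ge>s'. f r \<in> V)"
    using exists_least_iff[of "\<lambda>s. \<forall>r\<ge>s. f r \<in> V"] by blast
  have s_start: "s = 0 \<or> f (s - 1) \<notin> V"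
  proof (rule disjCI)
    assume notin: "\<not> f (s - 1) \<notin> V"
    have "\<forall>r\<ge>s - 1. f r \<in> V"
    proof (intro allI impI)
      fix r assume "s - 1 \<le> r"
      then have "r = s - 1 \<or> s \<le> r" by linarith
      with s notin show "f r \<in> V" by auto
    qed
    with least[of "s - 1"] show "s = 0" by (cases s) simp_all
  qed
  have "\<exists>k\<ge>K. renewal f V s k" for K
  proof -
    define L where "L = Suc (Suc (K + s))"
    have "MOST k. \<forall>u\<in>V. L \<le> occurrences f u k"
      unfolding MOST_finite_Ball_distrib[OF finV]
      using occurrences_unbounded unfolding V_def inf_values_def by blast
    then have "\<exists>k. \<forall>u\<in>V. L \<le> occurrences f u k" unfolding MOST_nat_le by blast
    then obtain l where l: "\<forall>u\<in>V. L \<le> occurrences f u l"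
      and l_least: "\<And>k. k < l \<Longrightarrow> \<not> (\<forall>u\<in>V. L \<le> occurrences f u k)"
      using exists_least_iff[of "\<lambda>k. \<forall>u\<in>V. L \<le> occurrences f u k"] by blast
    have "f s \<in> V" using s by simp
    with l have "L \<le> l" using occurrences_le[of f "f s" l] by (meson order_trans)
    then obtain k where k: "l = Suc k" unfolding L_def by (cases l) simp_all
    then obtain u where u: "u \<in> V" "occurrences f u k < L" using l_least[of k] by (auto simp: not_le)
    have "L \<le> occurrences f u (Suc k)" using l u(1) k by blast
    with u(2) have "f k = u" "occurrences f u (Suc k) = L" by (auto split: if_splits)
    with l k have "\<forall>v\<in>V. occurrences f (f k) (Suc k) \<le> occurrences f v (Suc k)" by simp
    moreover have "K \<le> k" "s \<le> k" using \<open>L \<le> l\<close> unfolding L_def k by simp_all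
    ultimately show ?thesis using s s_start unfolding renewal_def by blast
  qed
  then show ?thesis unfolding INFM_nat_le V_def by blast
qed

lemma renewal_cong:
  assumes "\<And>r. r \<le> k \<Longrightarrow> f r = g r"
  shows "renewal f V s k \<longleftrightarrow> renewal g V s k"
proof -
  have occ: "l \<le> Suc k \<Longrightarrow> occurrences f v l = occurrences g v l" for v l
    by (induction l) (auto simp: assms)
  show ?thesis
  proof (cases "s \<le> k")
    case True
    then have "f (s - 1) = g (s - 1)" "f k = g k" using assms by simp_all
    moreover have "(\<forall>r. s \<le> r \<and> r \<le> k \<longrightarrow> f r \<in> V) \<longleftrightarrow> (\<forall>r. s \<le> r \<and> r \<le> k \<longrightarrow> g r \<in> V)"
      using assms by auto
    ultimately show ?thesis unfolding renewal_def by (simp only: occ[OF order_refl])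
  qed (simp add: renewal_def)
qed

section \<open>What a machine can know after the first limit\<close>

text \<open>
  What a configuration shows of the first \<open>n\<close> cells of each tape. A head position leaves a trace only
  if it is below \<open>n\<close>. Lists are used so that windows can be numbered.
\<close>

definition window :: "program \<Rightarrow> nat \<Rightarrow> 'o::ordinals config \<Rightarrow> nat \<times> bool list list \<times> bool list list" where
  "window p n c =
     (state c,
      map (\<lambda>i. map (\<lambda>k. head c i = fin k) [0..<n]) [0..<n_tapes p],
      map (\<lambda>i. map (\<lambda>k. tape c i (fin k)) [0..<n]) [0..<n_tapes p])"

definition observation :: "program \<Rightarrow> nat \<Rightarrow> 'o::ordinals word \<Rightarrow> nat \<Rightarrow> nat" where
  "observation p n w k = to_nat (window p n (config_at p w (fin k)))"

lemma head_at_fin: "\<exists>m\<le>n. head (config_at p w (fin n)) i = fin m" for w :: "'o::ordinals word"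
proof (induction n)
  case 0
  show ?case by (simp add: config_at_zero initial_config_def)
next
  case (Suc n)
  then obtain m where m: "m \<le> n" "head (config_at p w (fin n)) i = fin m" by blast
  have move: "\<exists>l\<le>Suc n. move_head d (fin m) = (fin l :: 'o)" for d
  proof (cases d)
    case Left
    with m(1) show ?thesis by (metis diff_le_self le_Suc_eq le_trans move_head_Left_fin)
  next
    case Stay
    with m(1) show ?thesis by (intro exI[of _ m]) simp
  next
    case Right
    with m(1) show ?thesis by (intro exI[of _ "Suc m"]) simp
  qed
  show ?case
    using m move le_SucI[OF m(1)] by (auto simp: config_at_suc next_config_def Let_def split: prod.splits)
qed

lemma tape_beyond_omega:
  fixes w :: "'o::ordinals word"
  assumes "omega \<le> u"
  shows "tape (config_at p w (fin n)) i u = tape (initial_config w) i u"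
proof (induction n)
  case 0
  show ?case by (simp add: config_at_zero)
next
  case (Suc n)
  have "u \<noteq> head (config_at p w (fin n)) i"
    using head_at_fin[of n p w i] assms by (metis ord_plus_less_next_limit not_le)
  with Suc show ?case by (auto simp: config_at_suc next_config_def Let_def split: prod.splits)
qed

lemma finite_observations: "finite (range (observation p n w))" for w :: "'o::ordinals word"
proof (cases "\<exists>m. halted p (config_at p w (fin m))")
  case True
  then obtain m where m: "halted p (config_at p w (fin m))" by blast
  have "observation p n w k \<in> observation p n w ` {..m}" for k
  proof (cases "k \<le> m")
    case False
    then have "observation p n w k = observation p n w m"
      unfolding observation_def using halted_stays[OF m, of "fin k"] by simp
    then show ?thesis by simp
  qed simp
  then have "range (observation p n w) \<subseteq> observation p n w ` {..m}" by blast
  then show ?thesis by (rule finite_subset) simp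
next
  case False
  let ?B = "{bs :: bool list. set bs \<subseteq> UNIV \<and> length bs = n}"
  let ?A = "{..<n_states p} \<times> {bss. set bss \<subseteq> ?B \<and> length bss = n_tapes p} \<times> {bss. set bss \<subseteq> ?B \<and> length bss = n_tapes p}"
  have "finite ?B" by (rule finite_lists_length_eq) simp
  then have "finite ?A" by (intro finite_cartesian_product finite_lists_length_eq) simp_all
  moreover have "window p n (config_at p w (fin k)) \<in> ?A" for k
    using False by (auto simp: window_def halted_def not_le)
  then have "range (observation p n w) \<subseteq> to_nat ` ?A"
    unfolding observation_def by blast
  ultimately show ?thesis by (meson finite_imageI finite_subset)
qed

text \<open>
  A run has only finitely many windows, so whether a property of windows recurs can be read off the set of
  recurring windows.
\<close>

lemma window_transfer:
  fixes w w' :: "'o::ordinals word"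
  assumes "inf_values (observation p n w) = inf_values (observation p n w')"
    and "INFM k. \<Phi> (window p n (config_at p w (fin k)))"
  shows "INFM k. \<Phi> (window p n (config_at p w' (fin k)))"
proof -
  have *: "(INFM k. \<Phi> (window p n (config_at p v (fin k)))) \<longleftrightarrow>
      (\<exists>z\<in>inf_values (observation p n v). \<Phi> (from_nat z))" for v :: "'o word"
    using inf_values_INFM[OF finite_observations, of "\<lambda>z. \<Phi> (from_nat z)" p n v]
    by (simp add: observation_def)
  show ?thesis using assms unfolding * by simp
qed

text \<open>
  The cells that a window of size \<open>n\<close> does not determine at time \<open>\<omega>\<close>: cells from \<open>\<omega>\<close> on are still in their
  initial state, as the heads were at finite positions until then.
\<close>

definition gap :: "nat \<Rightarrow> 'o::ordinals set" where
  "gap n = {u. fin n \<le> u \<and> u < omega}"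

definition avoids_gap :: "program \<Rightarrow> nat \<Rightarrow> 'o::ordinals word \<Rightarrow> bool" where
  "avoids_gap p n w \<longleftrightarrow> (\<forall>j. \<forall>i<n_tapes p. head (config_at p w (omega \<oplus> j)) i \<notin> gap n)"

definition agree :: "program \<Rightarrow> nat \<Rightarrow> 'o::ordinals config \<Rightarrow> 'o config \<Rightarrow> bool" where
  "agree p n c d \<longleftrightarrow> state c = state d \<and>
     (\<forall>i<n_tapes p. head c i = head d i) \<and>
     (\<forall>i<n_tapes p. \<forall>u. u \<notin> gap n \<longrightarrow> tape c i u = tape d i u)"

text \<open>
  Every component of the configuration at time \<open>\<omega>\<close> is described by which properties hold infinitely
  often, in the form in which they can be transferred between runs.
\<close>

lemma config_at_omega:
  fixes w :: "'o::ordinals word" and p :: program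
  defines "C \<equiv> config_at p w" and "q \<equiv> state (config_at p w omega)"
  shows "INFM k. state (C (fin k)) = q"
    and "q \<le> v \<longleftrightarrow> (INFM k. state (C (fin k)) \<le> v)"
    and "head (C omega) i \<le> u \<longleftrightarrow> (INFM k. state (C (fin k)) = q \<and> head (C (fin k)) i \<le> u)"
    and "head (C omega) i \<le> omega"
    and "tape (C omega) i u \<longleftrightarrow> \<not> (INFM k. \<not> tape (C (fin k)) i u)"
proof -
  have lim: "C omega = limit_config omega C" unfolding C_def by (rule config_at_limit) simp_all
  have q: "q = liminf_at omega (\<lambda>_. True) (\<lambda>r. state (C r))"
    unfolding q_def C_def[symmetric] lim limit_config_def Let_def by simp
  have hd: "head (C omega) i = liminf_at omega (\<lambda>r. state (C r) = q) (\<lambda>r. head (C r) i)"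
    unfolding lim limit_config_def Let_def q by simp
  have "finite (range (\<lambda>k. state (C (fin k))))"
  proof -
    have "range (\<lambda>k. state (C (fin k))) \<subseteq> (\<lambda>z. fst (from_nat z :: nat \<times> bool list list \<times> bool list list)) ` range (observation p 0 w)"
      by (auto simp: observation_def C_def window_def image_iff)
    then show ?thesis using finite_observations by (meson finite_imageI finite_subset)
  qed
  then obtain B where B: "\<And>k. state (C (fin k)) \<le> B"
    by (auto simp: finite_nat_set_iff_bounded_le)
  have bound: "state (C r) \<le> B" if "r < omega" for r
    using that B unfolding less_omega_iff by blast
  have zero: "ord_zero < (omega :: 'o)" by simp
  have "\<exists>r. s \<le> r \<and> r < omega \<and> state (C r) = q" if "s < omega" for s
    unfolding q by (rule liminf_at_nat[OF zero _ that, of "\<lambda>r. state (C r)" B]) (rule bound)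
  then show often: "INFM k. state (C (fin k)) = q"
    using INFM_next_limit[of ord_zero "\<lambda>r. state (C r) = q"] by blast
  have "INFM k. True \<and> state (C (fin k)) \<le> q" using often by (rule INFM_mono) simp
  from liminf_next_limit_le_iff[where P = "\<lambda>_. True", OF this]
  show "q \<le> v \<longleftrightarrow> (INFM k. state (C (fin k)) \<le> v)" unfolding q by simp
  have head_le: "head (C (fin k)) i \<le> omega" for k
    using head_at_fin[of k p w i] unfolding C_def by (metis less_imp_le ord_plus_less_next_limit)
  have bdd: "INFM k. state (C (fin k)) = q \<and> head (C (fin k)) i \<le> omega"
    using often by (rule INFM_mono) (simp add: head_le)
  from liminf_next_limit_le_iff[where P = "\<lambda>r. state (C r) = q", OF this]
  show *: "head (C omega) i \<le> u \<longleftrightarrow> (INFM k. state (C (fin k)) = q \<and> head (C (fin k)) i \<le> u)" for u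
    unfolding hd by simp
  show "head (C omega) i \<le> omega" using * bdd by blast
  have "tape (C omega) i u \<longleftrightarrow> (MOST k. tape (C (fin k)) i u)"
    unfolding lim limit_config_def Let_def by (simp add: liminf_next_limit_bool)
  then show "tape (C omega) i u \<longleftrightarrow> \<not> (INFM k. \<not> tape (C (fin k)) i u)" by simp
qed

text \<open>
  A limit position that is not below \<open>n\<close> could be any later cell or \<open>\<omega>\<close>, which no window can tell apart.
  The assumption on the gap leaves \<open>\<omega>\<close> as the only possibility.
\<close>

lemma equal_heads_at_omega:
  fixes g h :: "'o::ordinals"
  assumes "g \<le> omega" "h \<le> omega" "g \<notin> gap n" "h \<notin> gap n"
    and iff: "\<And>k. k < n \<Longrightarrow> g \<le> fin k \<longleftrightarrow> h \<le> fin k"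
  shows "g = h"
proof -
  have cases_gap: "v = omega \<or> (\<exists>k<n. v = fin k)" if le: "v \<le> omega" and notin: "v \<notin> gap n" for v :: 'o
  proof (cases "v = omega")
    case False
    with le have "v < omega" by simp
    then obtain k where "v = fin k" unfolding less_omega_iff by blast
    with notin show ?thesis by (auto simp: gap_def not_le)
  qed simp
  have le: "v \<le> u" if "u \<le> omega" "u \<notin> gap n" "v \<le> omega" and imp: "\<And>k. k < n \<Longrightarrow> u \<le> fin k \<Longrightarrow> v \<le> fin k"
    for u v :: 'o
    using cases_gap[OF that(1,2)] that(3) imp order_refl by metis
  show ?thesis
  proof (rule order.antisym)
    show "g \<le> h" by (rule le[OF assms(2,4,1)]) (simp add: iff)
    show "h \<le> g" by (rule le[OF assms(1,3,2)]) (simp add: iff)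
  qed
qed

lemma agree_at_omega:
  fixes x y :: "nat \<Rightarrow> bool"
  assumes inf: "inf_values (observation p n (omega_word x :: 'o word)) = inf_values (observation p n (omega_word y :: 'o::ordinals word))"
    and gx: "avoids_gap p n (omega_word x :: 'o word)" and gy: "avoids_gap p n (omega_word y :: 'o word)"
  shows "agree p n (config_at p (omega_word x :: 'o word) omega) (config_at p (omega_word y) omega)"
proof -
  let ?x = "omega_word x :: 'o word" and ?y = "omega_word y :: 'o word"
  have transfer: "(INFM k. \<Phi> (window p n (config_at p ?x (fin k)))) \<longleftrightarrow>
      (INFM k. \<Phi> (window p n (config_at p ?y (fin k))))" for \<Phi>
    using window_transfer[OF inf] window_transfer[OF inf[symmetric]] by blast
  have "state (config_at p ?x omega) \<le> v \<longleftrightarrow> state (config_at p ?y omega) \<le> v" for v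
    unfolding config_at_omega(2) using transfer[of "\<lambda>z. fst z \<le> v"] by (simp add: window_def)
  then have st: "state (config_at p ?x omega) = state (config_at p ?y omega)"
    by (meson order.antisym order_refl)
  have le_fin: "head (config_at p w (fin m)) i \<le> fin k \<longleftrightarrow> (\<exists>l\<le>k. head (config_at p w (fin m)) i = fin l)"
    for w :: "'o word" and m i k
    using head_at_fin[of m p w i] by auto
  have hd: "head (config_at p ?x omega) i = head (config_at p ?y omega) i" if i: "i < n_tapes p" for i
  proof (rule equal_heads_at_omega)
    show "head (config_at p ?x omega) i \<notin> gap n" "head (config_at p ?y omega) i \<notin> gap n"
      using gx gy i unfolding avoids_gap_def by (metis funpow_0)+
    fix k assume k: "k < n"
    let ?P = "\<lambda>c. state c = state (config_at p ?y omega) \<and> (\<exists>l\<le>k. head c i = fin l)"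
    have P: "?P c \<longleftrightarrow> (\<lambda>z. fst z = state (config_at p ?y omega) \<and> (\<exists>l\<le>k. fst (snd z) ! i ! l)) (window p n c)"
      for c :: "'o config"
      using i k by (auto simp: window_def)
    show "head (config_at p ?x omega) i \<le> fin k \<longleftrightarrow> head (config_at p ?y omega) i \<le> fin k"
      unfolding config_at_omega(3) st le_fin P by (rule transfer)
  qed (rule config_at_omega(4))+
  have tp: "tape (config_at p ?x omega) i u = tape (config_at p ?y omega) i u"
    if i: "i < n_tapes p" and u: "u \<notin> gap n" for i u
  proof (cases "omega \<le> u")
    case True
    then show ?thesis
      unfolding config_at_omega(5) by (simp only: tape_beyond_omega initial_omega_word)
  next
    case False
    then have "u < omega" by simp
    then obtain k where "u = fin k" unfolding less_omega_iff by blast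
    with u have "u = fin k" "k < n" by (auto simp: gap_def not_le)
    then have "\<not> tape c i u \<longleftrightarrow> (\<lambda>z. \<not> snd (snd z) ! i ! k) (window p n c)" for c
      using i by (simp add: window_def)
    then show ?thesis
      unfolding config_at_omega(5) using transfer[of "\<lambda>z. \<not> snd (snd z) ! i ! k"] by simp
  qed
  show ?thesis unfolding agree_def using st hd tp by blast
qed

lemma agree_next:
  assumes agree: "agree p n c d" and low: "\<forall>i<n_tapes p. head c i \<notin> gap n"
  shows "agree p n (next_config p c) (next_config p d)"
proof -
  have st: "state c = state d"
    and hd: "\<And>i. i < n_tapes p \<Longrightarrow> head c i = head d i"
    and tp: "\<And>i u. i < n_tapes p \<Longrightarrow> u \<notin> gap n \<Longrightarrow> tape c i u = tape d i u"
    using agree unfolding agree_def by blast+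
  have sc: "scanned p c = scanned p d"
    unfolding scanned_def using hd tp low by (auto simp flip: hd)
  show ?thesis
  proof (cases "halted p c")
    case True
    with agree show ?thesis by (simp add: next_config_def halted_def st)
  next
    case False
    obtain q acts where "instr p (state d) (scanned p d) = (q, acts)" by fastforce
    with False show ?thesis
      by (auto simp: agree_def next_config_def halted_def st sc hd tp)
  qed
qed

text \<open>
  The recurring windows determine the outcome of the finitely many steps after the first limit: these steps
  start in configurations that agree outside the gap, and no head enters the gap, so the runs
  cannot diverge.
\<close>

lemma same_output:
  fixes x y :: "nat \<Rightarrow> bool" and p :: program
  defines "C \<equiv> \<lambda>x. config_at p (omega_word x :: 'o::ordinals word)"
  assumes inf: "inf_values (observation p n (omega_word x :: 'o word)) = inf_values (observation p n (omega_word y :: 'o word))"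
    and gx: "avoids_gap p n (omega_word x :: 'o word)" and gy: "avoids_gap p n (omega_word y :: 'o word)"
    and hx: "halted p (C x (omega \<oplus> k))" and hy: "halted p (C y (omega \<oplus> l))"
    and "0 < n" "i < n_tapes p"
  shows "tape (C x (omega \<oplus> k)) i ord_zero = tape (C y (omega \<oplus> l)) i ord_zero"
proof -
  have "agree p n (C x (omega \<oplus> j)) (C y (omega \<oplus> j))" for j
  proof (induction j)
    case 0
    show ?case using agree_at_omega[OF inf gx gy] by (simp add: C_def)
  next
    case (Suc j)
    then have "agree p n (next_config p (C x (omega \<oplus> j))) (next_config p (C y (omega \<oplus> j)))"
      using gx unfolding avoids_gap_def C_def by (intro agree_next) blast+
    then show ?case by (simp add: C_def config_at_suc)
  qed
  from this[of "max k l"] have "agree p n (C x (omega \<oplus> k)) (C y (omega \<oplus> l))"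
    using halted_stays[OF hx[unfolded C_def], of "omega \<oplus> max k l"]
      halted_stays[OF hy[unfolded C_def], of "omega \<oplus> max k l"] by (simp add: C_def)
  moreover have "ord_zero \<notin> (gap n :: 'o set)"
    using \<open>0 < n\<close> ord_plus_less_iff[of 0 "ord_zero :: 'o" n] unfolding gap_def by (simp add: not_le)
  ultimately show ?thesis using \<open>i < n_tapes p\<close> unfolding agree_def by blast
qed

text \<open>
  A halting computation visits finitely many cells after the first limit, and each cell is outside
  all sufficiently late gaps.
\<close>

lemma MOST_avoids_gap:
  fixes w :: "'o::ordinals word"
  assumes "halted p (config_at p w (omega \<oplus> m))"
  shows "MOST n. avoids_gap p n w"
proof -
  define H where "H = (\<lambda>(j, i). head (config_at p w (omega \<oplus> j)) i) ` ({..m} \<times> {..<n_tapes p})"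
  have "finite H" unfolding H_def by simp
  moreover have "MOST n. u \<notin> gap n" for u :: 'o
  proof (cases "u < omega")
    case True
    then obtain k where "u = fin k" unfolding less_omega_iff by blast
    then show ?thesis unfolding MOST_nat by (intro exI[of _ k]) (simp add: gap_def not_le)
  qed (simp add: gap_def)
  ultimately have "MOST n. \<forall>u\<in>H. u \<notin> gap n" by (simp add: MOST_finite_Ball_distrib)
  then show ?thesis
  proof (rule MOST_mono)
    fix n assume n: "\<forall>u\<in>H. u \<notin> (gap n :: 'o set)"
    have "head (config_at p w (omega \<oplus> j)) i \<in> H" if "i < n_tapes p" for i j
    proof (cases "j \<le> m")
      case True
      with that show ?thesis unfolding H_def by force
    next
      case False
      then have "config_at p w (omega \<oplus> j) = config_at p w (omega \<oplus> m)"
        by (intro halted_stays[OF assms]) simp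
      with that show ?thesis unfolding H_def by force
    qed
    with n show "avoids_gap p n w" unfolding avoids_gap_def by blast
  qed
qed

lemma halts_before_second_limit:
  fixes w :: "'o::ordinals word"
  assumes "halts_at p w t" "t \<le> ord_mult omega (ord_of_nat 2)"
  shows "\<exists>m. halted p (config_at p w (omega \<oplus> m))"
proof -
  have halted: "halted p (config_at p w t)" using assms(1) by (simp add: halts_at_def)
  have "t \<le> next_limit omega"
    using assms(2) ord_mult_two_le ord_add_omega_le by (meson order_trans)
  moreover have "t \<noteq> next_limit omega"
    using not_halted_at_limit[of t p w] assms(1) next_limit_neq_zero next_limit_not_suc
    unfolding halts_at_def by metis
  ultimately obtain m where "t \<le> omega \<oplus> m" using less_next_limitD by (metis order.not_eq_order_implies_strict)
  with halted_stays[OF halted] halted show ?thesis by metis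
qed

text \<open>
  In \<open>k\<close> steps only the first \<open>k\<close> input bits have been read. This causality is what permits the diagonal
  word to refer to the run of the machine on this very word.
\<close>

lemma observation_cong:
  fixes x y :: "nat \<Rightarrow> bool"
  assumes eq: "\<And>j. j < m \<Longrightarrow> x j = y j" and "k \<le> m" "n \<le> m"
  shows "observation p n (omega_word x :: 'o::ordinals word) k = observation p n (omega_word y :: 'o word) k"
proof -
  let ?x = "omega_word x :: 'o word" and ?y = "omega_word y :: 'o word"
  let ?same = "\<lambda>c d :: 'o config. state c = state d \<and> head c = head d \<and>
    (\<forall>i u. tape c i u = tape d i u \<or> (\<exists>j\<ge>m. u = fin j))"
  have same: "?same (config_at p ?x (fin k)) (config_at p ?y (fin k))" if "k \<le> m" for k
    using that
  proof (induction k)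
    case 0
    have "tape (initial_config ?x) i u = tape (initial_config ?y) i u \<or> (\<exists>j\<ge>m. u = fin j)" for i u
    proof (cases "omega \<le> u")
      case True
      then show ?thesis by (simp add: initial_omega_word)
    next
      case False
      then have "u < omega" by simp
      then obtain j where "u = fin j" unfolding less_omega_iff by blast
      then show ?thesis using eq[of j] by (auto simp: initial_config_def not_less)
    qed
    then show ?case by (simp add: config_at_zero) (simp add: initial_config_def)
  next
    case (Suc k)
    let ?c = "config_at p ?x (fin k)" and ?d = "config_at p ?y (fin k)"
    have IH: "state ?c = state ?d" "head ?c = head ?d" "\<And>i u. tape ?c i u = tape ?d i u \<or> (\<exists>j\<ge>m. u = fin j)"
      using Suc by auto
    have "tape ?c i (head ?c i) = tape ?d i (head ?d i)" for i
    proof -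
      obtain l where "l \<le> k" "head ?c i = fin l" using head_at_fin by blast
      with Suc.prems IH(2) IH(3)[of i "fin l"] show ?thesis by auto
    qed
    then have sc: "scanned p ?c = scanned p ?d" unfolding scanned_def by simp
    obtain q acts where "instr p (state ?d) (scanned p ?d) = (q, acts)" by fastforce
    with IH sc show ?case
      by (auto simp: config_at_suc next_config_def halted_def)
  qed
  have "tape (config_at p ?x (fin k)) i (fin l) = tape (config_at p ?y (fin k)) i (fin l)" if "l < n" for i l
    using same[OF \<open>k \<le> m\<close>] that \<open>n \<le> m\<close> by (metis leD order.strict_trans2 ord_plus_eq_iff)
  with same[OF \<open>k \<le> m\<close>] show ?thesis unfolding observation_def window_def by (simp cong: map_cong)
qed

section \<open>The diagonal word\<close>

text \<open>
  A fixed walk of the scratch head in laps: lap \<open>k\<close> goes from cell \<open>0\<close> up to cell \<open>k + 1\<close> and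
  back, so each cell \<open>j\<close> is visited in each lap \<open>k \<ge> j\<close>. The components are the
  position, the direction of the next move (\<open>True\<close> is to the right) and the lap.
\<close>

primrec walk :: "nat \<Rightarrow> nat \<times> bool \<times> nat" where
  "walk 0 = (0, True, 0)"
| "walk (Suc t) = (case walk t of (j, up, k) \<Rightarrow>
     if up then (Suc j, j < k, k) else (j - 1, j = 1, if j = 1 then Suc k else k))"

definition pos :: "nat \<Rightarrow> nat" where "pos t = fst (walk t)"
definition rising :: "nat \<Rightarrow> bool" where "rising t = fst (snd (walk t))"
definition lap :: "nat \<Rightarrow> nat" where "lap t = snd (snd (walk t))"

lemma walk_bounds: "pos t \<le> t \<and> lap t \<le> t"
  unfolding pos_def lap_def by (induction t) (auto split: prod.splits)

lemma lap_mono: "s \<le> t \<Longrightarrow> lap s \<le> lap t"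
  by (rule lift_Suc_mono_le[of lap]) (auto simp: lap_def split: prod.splits)

lemma walk_visits: "j \<le> k \<Longrightarrow> \<exists>t. walk t = (j, True, k)"
proof (induction k arbitrary: j)
  case 0
  then show ?case by (intro exI[of _ 0]) simp
next
  case (Suc k)
  have down: "\<exists>t. walk t = (Suc k - i, False, k)" if "i \<le> k" for i
    using that
  proof (induction i)
    case 0
    obtain t where "walk t = (k, True, k)" using Suc.IH by blast
    then show ?case by (intro exI[of _ "Suc t"]) simp
  next
    case (Suc i)
    then obtain t where "walk t = (Suc k - i, False, k)" by auto
    with Suc.prems show ?case by (intro exI[of _ "Suc t"]) auto
  qed
  have up: "\<exists>t. walk t = (j, True, Suc k)" if "j \<le> Suc k" for j
    using that
  proof (induction j)
    case 0
    obtain t where "walk t = (1, False, k)" using down[of k] by auto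
    then show ?case by (intro exI[of _ "Suc t"]) simp
  next
    case (Suc j)
    then obtain t where "walk t = (j, True, Suc k)" by auto
    with Suc.prems show ?case by (intro exI[of _ "Suc t"]) simp
  qed
  then show ?case using Suc.prems by blast
qed

lemma causal_fixed_point:
  fixes F :: "(nat \<Rightarrow> 'a) \<Rightarrow> nat \<Rightarrow> 'a"
  assumes "\<And>m x y. (\<And>i. i < m \<Longrightarrow> x i = y i) \<Longrightarrow> F x m = F y m"
  shows "\<exists>x. \<forall>m. x m = F x m"
proof (rule dependent_wf_choice[of less_than "\<lambda>x m r. r = F x m"])
  show "(r = F x m) = (r = F y m)" if "\<And>i. (i, m) \<in> less_than \<Longrightarrow> x i = y i" for x y m r
    using assms[of m x y] that by simp
qed simp_all

text \<open>
  The commands at odd positions realize the fixed walk. The bit written at cell \<open>j\<close> in lap \<open>k\<close> is the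
  negation of \<open>E j k\<close>, evaluated for the word under construction; as it depends on earlier
  bits only, the recursion is sound. Within one lap all writes to a cell agree, so the limit content of cell \<open>j\<close>
  is \<open>0\<close> iff \<open>E j k\<close> holds for infinitely many laps \<open>k\<close>.
\<close>

lemma diagonal_sequence:
  assumes causal: "\<And>t x y. (\<And>i. i < 2 * t \<Longrightarrow> x i = y i) \<Longrightarrow> E (pos t) (lap t) x \<longleftrightarrow> E (pos t) (lap t) y"
  obtains x where "\<And>j. (MOST t. written x t j) \<longleftrightarrow> \<not> (INFM k. E j k x)"
proof -
  let ?F = "\<lambda>x m. if odd m then rising (m div 2) else \<not> E (pos (m div 2)) (lap (m div 2)) x"
  have "\<exists>x. \<forall>m. x m = ?F x m"
  proof (rule causal_fixed_point)
    fix m and x y :: "nat \<Rightarrow> bool"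
    assume "\<And>i. i < m \<Longrightarrow> x i = y i"
    then have "E (pos (m div 2)) (lap (m div 2)) x \<longleftrightarrow> E (pos (m div 2)) (lap (m div 2)) y"
      by (intro causal) simp
    then show "?F x m = ?F y m" by simp
  qed
  then obtain x where x: "\<And>m. x m = ?F x m" by blast
  have x_odd: "x (Suc (2 * t)) = rising t" for t using x[of "Suc (2 * t)"] by simp
  have x_even: "x (2 * t) = (\<not> E (pos t) (lap t) x)" for t using x[of "2 * t"] by simp
  have track: "track x t = pos t" for t
    by (induction t) (auto simp: x_odd pos_def rising_def split: prod.splits)
  have written: "written x (Suc t) j = (if j = pos t then \<not> E j (lap t) x else written x t j)" for t j
    by (simp add: x_even track)
  have "(MOST t. written x t j) \<longleftrightarrow> \<not> (INFM k. E j k x)" for j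
  proof
    assume "MOST t. written x t j"
    then obtain T where T: "\<And>t. T \<le> t \<Longrightarrow> written x t j" unfolding MOST_nat_le by blast
    have "\<not> E j k x" if k: "max T j \<le> k" for k
    proof -
      obtain t where "walk t = (j, True, k)" using walk_visits[of j k] k by auto
      then have t: "pos t = j" "lap t = k" by (simp_all add: pos_def lap_def)
      then have "written x (Suc t) j" using T[of "Suc t"] walk_bounds[of t] k by (simp del: written.simps)
      then show ?thesis unfolding written t by simp
    qed
    then show "\<not> (INFM k. E j k x)" unfolding INFM_nat_le by blast
  next
    assume "\<not> (INFM k. E j k x)"
    then obtain K where K: "\<And>k. K \<le> k \<Longrightarrow> \<not> E j k x" unfolding INFM_nat_le by blast
    obtain s where "walk s = (j, True, max K j)" using walk_visits[of j "max K j"] by auto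
    then have s: "pos s = j" "lap s = max K j" by (simp_all add: pos_def lap_def)
    have "written x t j" if "Suc s \<le> t" for t
      using that
    proof (induction t rule: dec_induct)
      case base
      show ?case unfolding written s using K by simp
    next
      case (step t)
      then have "K \<le> lap t" using lap_mono[of s t] s(2) by simp
      with step K[of "lap t"] show ?case unfolding written by presburger
    qed
    then show "MOST t. written x t j" unfolding MOST_nat_le by blast
  qed
  then show thesis by (rule that)
qed

text \<open>
  Against a fast machine \<open>p\<close>, cell \<open>j = (n, V, s)\<close> of the scratch tape is used to test whether \<open>V\<close> is the set of
  recurring windows of size \<open>n\<close> and leads to rejection. For each \<open>n\<close> at most one pair of \<open>V\<close> and \<open>s\<close>
  passes; for all large \<open>n\<close> some pair passes if \<open>p\<close> rejects the diagonal word, and none does if \<open>p\<close>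
  accepts it. So infinitely many cells are \<open>0\<close> in the limit iff \<open>p\<close> rejects.
\<close>

lemma swept_words_not_in_time: "\<not> decidable_in_time_times (swept_words :: 'o::ordinals word set) 2"
proof
  assume "decidable_in_time_times (swept_words :: 'o word set) 2"
  then obtain p where dec: "decides p (swept_words :: 'o word set)"
    and time: "\<forall>w\<in>(words :: 'o word set). w \<noteq> Map.empty \<longrightarrow>
      (\<exists>t. halts_at p w t \<and> t \<le> ord_mult (word_length w) (ord_of_nat 2))"
    unfolding decidable_in_time_times_def by blast
  let ?w = "\<lambda>x. omega_word x :: 'o word"
  have halt: "\<exists>m. halted p (config_at p (?w x) (omega \<oplus> m)) \<and>
      (tape (config_at p (?w x) (omega \<oplus> m)) 2 ord_zero \<longleftrightarrow> ?w x \<in> swept_words)" for x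
  proof -
    have "?w x \<noteq> Map.empty" using omega_word_fin[of x 0] by (metis option.distinct(1))
    with time obtain t where t: "halts_at p (?w x) t" "t \<le> ord_mult omega (ord_of_nat 2)"
      by (metis omega_word_in_words word_length_omega_word)
    from halts_before_second_limit[OF this] obtain m where m: "halted p (config_at p (?w x) (omega \<oplus> m))" by blast
    obtain s where s: "halts_at p (?w x) s" "tape (config_at p (?w x) s) 2 ord_zero \<longleftrightarrow> ?w x \<in> swept_words"
      using dec unfolding decides_def by (metis omega_word_in_words)
    then have "halted p (config_at p (?w x) s)" "s \<le> omega \<oplus> m"
      using m unfolding halts_at_def by (auto simp: not_less[symmetric])
    then have "config_at p (?w x) (omega \<oplus> m) = config_at p (?w x) s" by (rule halted_stays)
    with m s(2) show ?thesis by (intro exI[of _ m]) simp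
  qed
  have tapes: "2 < n_tapes p" using dec unfolding decides_def wf_program_def by simp

  let ?obs = "\<lambda>n x. observation p n (?w x)"
  \<comment> \<open>Instead of simulating \<open>p\<close> from a set of windows, the outcome is borrowed from any word with these recurring windows.\<close>
  define rejecting where "rejecting n V \<longleftrightarrow>
    (\<exists>y. avoids_gap p n (?w y) \<and> inf_values (?obs n y) = V \<and> ?w y \<notin> swept_words)" for n V
  have rejecting: "rejecting n (inf_values (?obs n x)) \<longleftrightarrow> ?w x \<notin> swept_words"
    if avoids: "avoids_gap p n (?w x)" and "0 < n" for n x
  proof -
    have "?w x \<in> swept_words \<longleftrightarrow> ?w y \<in> swept_words"
      if y: "avoids_gap p n (?w y)" "inf_values (?obs n y) = inf_values (?obs n x)" for y
    proof -
      obtain k l where kl: "halted p (config_at p (?w x) (omega \<oplus> k))"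
          "tape (config_at p (?w x) (omega \<oplus> k)) 2 ord_zero \<longleftrightarrow> ?w x \<in> swept_words"
          "halted p (config_at p (?w y) (omega \<oplus> l))"
          "tape (config_at p (?w y) (omega \<oplus> l)) 2 ord_zero \<longleftrightarrow> ?w y \<in> swept_words"
        using halt by metis
      from same_output[OF y(2)[symmetric] avoids y(1) kl(1,3) \<open>0 < n\<close> tapes] kl(2,4) show ?thesis by simp
    qed
    with avoids show ?thesis unfolding rejecting_def by blast
  qed

  define E where "E j k x = (case prod_decode j of (n, c) \<Rightarrow> case prod_decode c of (v, s) \<Rightarrow>
    0 < n \<and> rejecting n (set_decode v) \<and> renewal (?obs n x) (set_decode v) s k)" for j k x
  have E: "E (prod_encode (n, prod_encode (v, s))) k x \<longleftrightarrow>
      0 < n \<and> rejecting n (set_decode v) \<and> renewal (?obs n x) (set_decode v) s k" for n v s k x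
    by (simp add: E_def)
  have code: "\<exists>n v s. j = prod_encode (n, prod_encode (v, s))" for j
    by (metis prod_decode_inverse surj_pair)
  \<comment> \<open>The window size is bounded by the code \<open>pos t\<close> of the triple, hence by the number of bits already fixed.\<close>
  have "E (pos t) (lap t) x \<longleftrightarrow> E (pos t) (lap t) y" if eq: "\<And>i. i < 2 * t \<Longrightarrow> x i = y i" for t x y
  proof -
    obtain n v s where j: "pos t = prod_encode (n, prod_encode (v, s))" using code by blast
    have "n \<le> 2 * t" using le_prod_encode_1[of n "prod_encode (v, s)"] walk_bounds[of t] j by linarith
    then have "renewal (?obs n x) (set_decode v) s (lap t) \<longleftrightarrow> renewal (?obs n y) (set_decode v) s (lap t)"
      using walk_bounds[of t] by (intro renewal_cong observation_cong[of "2 * t"] eq) auto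
    then show ?thesis unfolding j E by blast
  qed
  then obtain x where x: "\<And>j. (MOST t. written x t j) \<longleftrightarrow> \<not> (INFM k. E j k x)"
    using diagonal_sequence[of E] by blast
  have swept: "?w x \<in> swept_words \<longleftrightarrow> (INFM j. INFM k. E j k x)"
    unfolding swept_omega_word_iff x by simp
  obtain N where N: "\<And>n. N \<le> n \<Longrightarrow> avoids_gap p n (?w x)"
    using halt[of x] MOST_avoids_gap unfolding MOST_nat_le by blast
  have shape: "0 < n \<and> rejecting n (inf_values (?obs n x)) \<and> set_decode v = inf_values (?obs n x) \<and>
      (INFM k. renewal (?obs n x) (inf_values (?obs n x)) s k)"
    if "INFM k. E (prod_encode (n, prod_encode (v, s))) k x" for n v s
  proof -
    have "0 < n \<and> rejecting n (set_decode v)" using that unfolding E by (auto dest: INFM_EX)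
    moreover have renew: "INFM k. renewal (?obs n x) (set_decode v) s k"
      using that unfolding E by (rule INFM_mono) blast
    moreover have "set_decode v = inf_values (?obs n x)"
      using finite_set_decode renew by (rule renewal_inf_values)
    ultimately show ?thesis by simp
  qed
  show False
  proof (cases "?w x \<in> swept_words")
    case True
    let ?J = "{j. INFM k. E j k x}"
    have "inj_on (\<lambda>j. fst (prod_decode j)) ?J"
    proof (rule inj_onI)
      fix j j' assume J: "j \<in> ?J" "j' \<in> ?J" and same: "fst (prod_decode j) = fst (prod_decode j')"
      obtain n v s where j: "j = prod_encode (n, prod_encode (v, s))" using code by blast
      obtain n' v' s' where j': "j' = prod_encode (n', prod_encode (v', s'))" using code by blast
      have n: "n' = n" using same unfolding j j' by simp
      note sj = shape[of n v s] and sj' = shape[of n v' s']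
      have "set_decode v = set_decode v'" using sj sj' J unfolding j j' n by simp
      then have "v = v'" by (metis set_decode_inverse)
      moreover have "s = s'"
        using sj sj' J renewal_unique[of "?obs n x" "inf_values (?obs n x)" s s'] unfolding j j' n by simp
      ultimately show "j = j'" unfolding j j' n by simp
    qed
    moreover have "(\<lambda>j. fst (prod_decode j)) ` ?J \<subseteq> {..<N}"
    proof (rule image_subsetI)
      fix j assume "j \<in> ?J"
      then have J: "INFM k. E j k x" by simp
      obtain n v s where j: "j = prod_encode (n, prod_encode (v, s))" using code by blast
      have "n < N"
      proof (rule ccontr)
        assume "\<not> n < N"
        then have "N \<le> n" by simp
        with shape[OF J[unfolded j]] rejecting[OF N, of n] True show False by blast
      qed
      then show "fst (prod_decode j) \<in> {..<N}" unfolding j by simp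
    qed
    ultimately have "finite ?J" by (rule inj_on_finite) simp
    with True swept show False by (simp add: frequently_cofinite)
  next
    case False
    have "\<exists>j\<ge>n. INFM k. E j k x" for n
    proof -
      define m where "m = Suc (max n N)"
      have m: "n \<le> m" "N \<le> m" "0 < m" unfolding m_def by simp_all
      let ?V = "inf_values (?obs m x)"
      have "?V \<subseteq> range (?obs m x)" unfolding inf_values_def by (auto dest: INFM_EX)
      then have fin: "finite ?V" using finite_observations by (rule finite_subset)
      obtain s where s: "INFM k. renewal (?obs m x) ?V s k" using renewal_exists[OF finite_observations] by blast
      have "rejecting m ?V" using rejecting[OF N[OF m(2)] m(3)] False by simp
      with s fin m(3) have "INFM k. E (prod_encode (m, prod_encode (set_encode ?V, s))) k x"
        unfolding E by simp
      moreover have "n \<le> prod_encode (m, prod_encode (set_encode ?V, s))"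
        using m(1) le_prod_encode_1 by (rule order_trans)
      ultimately show ?thesis by blast
    qed
    then have "?w x \<in> swept_words" unfolding swept by (subst INFM_nat_le) blast
    with False show False ..
  qed
qed

theorem theorem7:
  shows "\<exists>L :: 'o::ordinals word set.
    L \<subseteq> words \<and> decidable_in_time_times L 4 \<and> \<not> decidable_in_time_times L 2"
proof (intro exI conjI)
  show "(swept_words :: 'o word set) \<subseteq> words" by (auto simp: swept_words_def)
qed (rule swept_words_in_time swept_words_not_in_time)+

end
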